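(* Let $\mathrm{Coup}(E)$ be a connected coupling graph on $[n]$, $n\ge 3$, and let $\Gamma=(Q,C)$ be a quantum circuit with $n$ qubits and $m\ge1$ gates. Consider the linear programs (SPP), (RSPP) and (GNFP) defined in the context. (a) (RSPP) is an equivalent formulation of (SPP), obtained by replacing every variable $x_e$, $e\in W^k_i$, by $\lambda^k_i$ and every variable $y_e$, $e\in Z^k_i$, by $\theta^k_i$, and keeping one flow conservation constraint per vertex orbit. If $(\lambda,\theta)$ is an optimal solution of (RSPP), then $(x,y)$ defined by $x_e=\lambda^k_i$ for $e\in W^k_i$ and $y_e=\theta^k_i$ for $e\in Z^k_i$ is an optimal solution of (SPP). (b) Substituting into (RSPP) the flow variables $f_i=d^+(Z^0_i)\,\theta^0_i$ for orbitals $Z^0_i$, $f_i=\theta^k_i$ for orbitals $Z^k_i$ with $k\in[m]$, and $f_i=d^+(W^k_i)\lambda^k_i$ for orbitals $W^k_i$ with $k\in[m]$, together with the costs $w_i$ and multipliers $p_i$ given in the context, yields an equivalent linear program (GNFP), which has the structure of a minimum cost generalized network flow problem on the quotient graph of $X$ under $G_X$. An optimal $(\lambda,\theta)$ for (RSPP) can be obtained from an optimal $f$ for (GNFP) through these relations. In particular, solving (RSPP) or (GNFP) provides the optimal cost of a shortest $(s,t)$-path in $X$, i.e. the optimal value of (SPP).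
   Context: Notation: $[n]=\{1,\dots,n\}$; $\mathbb{S}_n$ is the symmetric group on $[n]$; products are compositions; $\tau^{-1}(S)=\{\tau^{-1}(s):s\in S\}$. Coupling graph: a simple undirected connected graph $\mathrm{Coup}(E)=([n],E)$, with $T=\{(i~j):\{i,j\}\in E\}\subseteq\mathbb{S}_n$. Qubits $Q$ are identified with $[n]$; a gate is a two-element subset of $Q$; a circuit is $\Gamma=(Q,C)$ with $C=(g^1,\dots,g^m)$ a sequence of gates. $F^k=\{\tau\in\mathbb{S}_n:\tau^{-1}(g^k)\in E\}$. Graph $X=(V,A)$: vertices $s$, $t$ and disjoint copies $V^k=\{\tau^k:\tau\in\mathbb{S}_n\}$, $k\in[m]$; arcs $A^1\cup\dots\cup A^m\cup D^0\cup\dots\cup D^m$ with $A^k=\{(\tau^k,(\tau\sigma)^k):\tau\in\mathbb{S}_n,\sigma\in T\}$, $D^0=\{(s,\tau^1):\tau\in\mathbb{S}_n\}$, $D^k=\{(\tau^k,\tau^{k+1}):\tau\in F^k\}$ for $1\le k\le m-1$, $D^m=\{(\tau^m,t):\tau\in F^m\}$. Arcs in the $A^k$ have cost $1$, arcs in the $D^k$ have cost $0$. For a vertex $v$ and arc set $A'$, $\delta^+(v,A')$ / $\delta^-(v,A')$ is the set of arcs of $A'$ leaving / entering $v$ (with $A'$ omitted when it is the full arc set). (SPP): minimize $\sum_{k=1}^m\sum_{e\in A^k}x_e$ subject to $\sum_{e\in D^0}y_e=1$, $\sum_{e\in D^m}y_e=1$; for all $k\in[m]$, $\tau\in V^k$: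 $\sum_{e\in\delta^-(\tau,D^{k-1})}y_e+\sum_{e\in\delta^-(\tau,A^k)}x_e=\sum_{e\in\delta^+(\tau,D^k)}y_e+\sum_{e\in\delta^+(\tau,A^k)}x_e$; and $0\le x_e\le1$ for $e\in A^k$, $k\in[m]$, $0\le y_e\le 1$ for $e\in D^k$, $k\in\{0\}\cup[m]$. Group $G_X$: the gate graph $(Q,U)$ has edge set $U=\{g:g\in C\}$. The fixing pattern $\mathcal{F}=\{S_1,\dots,S_l\}$ is the partition of $Q$ into: singletons for qubits in connected components of $(Q,U)$ of size at least 3; pairs forming components of size 2; and the set of all isolated vertices (if nonempty). $\mathbb{S}_n(\mathcal{F})=\{a\in\mathbb{S}_n:a(S_i)=S_i\ \forall i\}$. $G_X\cong\mathbb{S}_n(\mathcal{F})\times\mathrm{Aut}(\mathrm{Coup}(E))$ is the group of automorphisms of $X$ that fix $s,t$ and map $\tau^k\mapsto(a\tau b^{-1})^k$ for all $\tau,k$, where $(a,b)\in\mathbb{S}_n(\mathcal{F})\times\mathrm{Aut}(\mathrm{Coup}(E))$. It preserves each $V^k,A^k,D^k$. Orbits on vertices are called orbits, orbits on arcs are called orbitals. $W^k_i$ ($i\in A^k/G_X$) are the orbitals in $A^k$; $Z^k_i$ ($i\in D^k/G_X$) the orbitals in $D^k$; $O^k_u$ ($u\in V^k/G_X$) the orbits in $V^k$. All arcs of an orbital start in one orbit and end in one orbit. $d^+(W^k_i)$ (resp. $d^-(W^k_i)$) is the number of arcs of $W^k_i$ leaving (resp. entering) any vertex at which some arc of $W^k_i$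 starts (resp. ends); this does not depend on the vertex. $d^+(Z^0_i)=|Z^0_i|$ is the number of arcs of $Z^0_i$ leaving $s$, and $d^-(Z^m_i)=|Z^m_i|$ the number of arcs of $Z^m_i$ entering $t$. $\delta^{+}(O^k_u,\cdot)$ / $\delta^-(O^k_u,\cdot)$ denotes the set of (indices of) orbitals in the given quotient whose arcs start / end in $O^k_u$. (RSPP): minimize $\sum_{k=1}^m\sum_{i\in A^k/G_X}|W^k_i|\lambda^k_i$ subject to $\sum_{i\in D^0/G_X}d^+(Z^0_i)\theta^0_i=1$, $\sum_{i\in D^m/G_X}d^-(Z^m_i)\theta^m_i=1$; for all $k\in[m]$, $u\in V^k/G_X$: $\sum_{i\in\delta^-(O^k_u,D^{k-1}/G_X)}\theta^{k-1}_i+\sum_{i\in\delta^-(O^k_u,A^k/G_X)}d^-(W^k_i)\lambda^k_i=\sum_{i\in\delta^+(O^k_u,D^k/G_X)}\theta^k_i+\sum_{i\in\delta^+(O^k_u,A^k/G_X)}d^+(W^k_i)\lambda^k_i$; and $0\le\lambda^k_i\le1$ for $i\in A^k/G_X$, $k\in[m]$, $0\le\theta^k_i\le1$ for $i\in D^k/G_X$, $k\in\{0\}\cup[m]$. (GNFP): on the quotient graph $\mathcal{X}=(\mathcal{V},\mathcal{A})$ with vertex set $\mathcal{V}=V/G_X$ (including $s,t$) and one arc in $\mathcal{A}=A/G_X$ for each orbital, from the orbit where its arcs start to the orbit where they end (loops and multi-arcs allowed). Each $i\in\mathcal{A}$ has a flow variable $f_i$, cost $w_i$, upper bound $u_i$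 and multiplier $p_i$. Costs: $w_i=|W^k_i|/d^+(W^k_i)$ if $i$ corresponds to $W^k_i$, $k\in[m]$, and $w_i=0$ otherwise. Upper bounds: $u_i=d^+(Z^0_i)$ for $Z^0_i$; $u_i=1$ for $Z^k_i$, $k\in[m]$; $u_i=d^+(W^k_i)$ for $W^k_i$, $k\in[m]$. Multipliers: $p_i=d^-(W^k_i)/d^+(W^k_i)$ for $W^k_i$, $k\in[m]$; $p_i=d^-(Z^m_i)$ for $Z^m_i$; $p_i=1$ otherwise (that is, for all $Z^k_i$ with $0\le k\le m-1$). The program is: minimize $\sum_{i\in\mathcal{A}}w_if_i$ subject to $\sum_{i\in\delta^+(s)}f_i=1$, $\sum_{i\in\delta^-(t)}p_if_i=1$, $\sum_{i\in\delta^+(v)}f_i=\sum_{i\in\delta^-(v)}p_if_i$ for all $v\in\mathcal{V}\setminus\{s,t\}$, and $0\le f_i\le u_i$ for all $i\in\mathcal{A}$.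
   Formalization: The multiplier of the source orbitals Z^0_i in (GNFP) is taken as 1/d^+(Z^0_i) instead of the printed 1; with 1, (GNFP) is infeasible whenever the group G_X is nontrivial (e.g. n=3, complete coupling graph, one gate), and for trivial G_X both values agree. *)

theory Defs
  imports Complex_Main "HOL-Algebra.Sym_Groups" "HOL-Algebra.Group_Action" "HOL-Algebra.Bij"
    "Graph_Theory.Weighted_Graph"
begin

section \<open>Coupling graphs, circuits and the layered digraph\<close>

definition coupling_graph :: "nat \<Rightarrow> nat set set \<Rightarrow> bool" where
  "coupling_graph n E \<longleftrightarrow>
     (\<forall>e\<in>E. e \<subseteq> {1..n} \<and> card e = 2) \<and>
     (\<forall>i\<in>{1..n}. \<forall>j\<in>{1..n}. (i, j) \<in> {(u, v). {u, v} \<in> E}\<^sup>*)"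

definition circuit :: "nat \<Rightarrow> nat set list \<Rightarrow> bool" where
  "circuit n C \<longleftrightarrow> (\<forall>g\<in>set C. g \<subseteq> {1..n} \<and> card g = 2)"

abbreviation Sn :: "nat \<Rightarrow> (nat \<Rightarrow> nat) set" where
  "Sn n \<equiv> carrier (sym_group n)"

definition swaps :: "nat set set \<Rightarrow> (nat \<Rightarrow> nat) set" where
  "swaps E = {transpose i j | i j. {i, j} \<in> E}"

text \<open>Gates are numbered from 1 in the index \<open>k\<close>, but from 0 in the list \<open>C\<close>.\<close>

definition gate_perms :: "nat \<Rightarrow> nat set set \<Rightarrow> nat set list \<Rightarrow> nat \<Rightarrow> (nat \<Rightarrow> nat) set" where
  "gate_perms n E C k = {\<tau> \<in> Sn n. inv' \<tau> ` (C ! (k - 1)) \<in> E}"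

datatype vertex = Src | Snk | Copy nat "nat \<Rightarrow> nat"

type_synonym arc = "vertex \<times> vertex"

definition layer :: "nat \<Rightarrow> nat \<Rightarrow> vertex set" where
  "layer n k = Copy k ` Sn n"

definition A_arcs :: "nat \<Rightarrow> nat set set \<Rightarrow> nat \<Rightarrow> arc set" where
  "A_arcs n E k = {(Copy k \<tau>, Copy k (\<tau> \<circ> \<sigma>)) | \<tau> \<sigma>. \<tau> \<in> Sn n \<and> \<sigma> \<in> swaps E}"

definition D_arcs :: "nat \<Rightarrow> nat set set \<Rightarrow> nat set list \<Rightarrow> nat \<Rightarrow> arc set" where
  "D_arcs n E C k =
     (if k = 0 then {(Src, Copy 1 \<tau>) | \<tau>. \<tau> \<in> Sn n}
      else if k = length C then {(Copy k \<tau>, Snk) | \<tau>. \<tau> \<in> gate_perms n E C k}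
      else {(Copy k \<tau>, Copy (k + 1) \<tau>) | \<tau>. \<tau> \<in> gate_perms n E C k})"

definition X :: "nat \<Rightarrow> nat set set \<Rightarrow> nat set list \<Rightarrow> (vertex, arc) pre_digraph" where
  "X n E C =
     \<lparr>verts = {Src, Snk} \<union> (\<Union>k\<in>{1..length C}. layer n k),
      arcs = (\<Union>k\<in>{1..length C}. A_arcs n E k) \<union> (\<Union>k\<in>{0..length C}. D_arcs n E C k),
      tail = fst,
      head = snd\<rparr>"

definition arc_cost :: "nat \<Rightarrow> nat set set \<Rightarrow> nat set list \<Rightarrow> arc \<Rightarrow> real" where
  "arc_cost n E C e = (if e \<in> (\<Union>k\<in>{1..length C}. A_arcs n E k) then 1 else 0)"


section \<open>Optimal values\<close>

definition opt_value :: "('z \<Rightarrow> real) \<Rightarrow> ('z \<Rightarrow> bool) \<Rightarrow> real \<Rightarrow> bool" where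
  "opt_value cost feasible v \<longleftrightarrow> (\<exists>z. is_arg_min cost feasible z \<and> cost z = v)"


section \<open>The linear program (SPP)\<close>

definition spp_cost ::
  "nat \<Rightarrow> nat set set \<Rightarrow> nat set list \<Rightarrow> (arc \<Rightarrow> real) \<times> (arc \<Rightarrow> real) \<Rightarrow> real" where
  "spp_cost n E C = (\<lambda>(x, y). \<Sum>k=1..length C. \<Sum>e\<in>A_arcs n E k. x e)"

definition spp_source :: "nat \<Rightarrow> nat set set \<Rightarrow> nat set list \<Rightarrow> (arc \<Rightarrow> real) \<Rightarrow> real" where
  "spp_source n E C y = (\<Sum>e\<in>D_arcs n E C 0. y e)"

definition spp_sink :: "nat \<Rightarrow> nat set set \<Rightarrow> nat set list \<Rightarrow> (arc \<Rightarrow> real) \<Rightarrow> real" where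
  "spp_sink n E C y = (\<Sum>e\<in>D_arcs n E C (length C). y e)"

definition spp_in ::
  "nat \<Rightarrow> nat set set \<Rightarrow> nat set list \<Rightarrow> (arc \<Rightarrow> real) \<Rightarrow> (arc \<Rightarrow> real) \<Rightarrow> nat \<Rightarrow> vertex \<Rightarrow> real" where
  "spp_in n E C x y k v =
     (\<Sum>e\<in>in_arcs (X n E C) v \<inter> D_arcs n E C (k - 1). y e) +
     (\<Sum>e\<in>in_arcs (X n E C) v \<inter> A_arcs n E k. x e)"

definition spp_out ::
  "nat \<Rightarrow> nat set set \<Rightarrow> nat set list \<Rightarrow> (arc \<Rightarrow> real) \<Rightarrow> (arc \<Rightarrow> real) \<Rightarrow> nat \<Rightarrow> vertex \<Rightarrow> real" where
  "spp_out n E C x y k v =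
     (\<Sum>e\<in>out_arcs (X n E C) v \<inter> D_arcs n E C k. y e) +
     (\<Sum>e\<in>out_arcs (X n E C) v \<inter> A_arcs n E k. x e)"

definition spp_feasible ::
  "nat \<Rightarrow> nat set set \<Rightarrow> nat set list \<Rightarrow> (arc \<Rightarrow> real) \<times> (arc \<Rightarrow> real) \<Rightarrow> bool" where
  "spp_feasible n E C = (\<lambda>(x, y).
     spp_source n E C y = 1 \<and>
     spp_sink n E C y = 1 \<and>
     (\<forall>k\<in>{1..length C}. \<forall>v\<in>layer n k. spp_in n E C x y k v = spp_out n E C x y k v) \<and>
     (\<forall>k\<in>{1..length C}. \<forall>e\<in>A_arcs n E k. 0 \<le> x e \<and> x e \<le> 1) \<and>
     (\<forall>k\<in>{0..length C}. \<forall>e\<in>D_arcs n E C k. 0 \<le> y e \<and> y e \<le> 1))"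


section \<open>The symmetry group, its orbits and its orbitals\<close>

definition component :: "nat \<Rightarrow> nat set list \<Rightarrow> nat \<Rightarrow> nat set" where
  "component n C q = {r \<in> {1..n}. (q, r) \<in> {(u, v). {u, v} \<in> set C}\<^sup>*}"

definition fixing_pattern :: "nat \<Rightarrow> nat set list \<Rightarrow> nat set set" where
  "fixing_pattern n C =
     {{q} | q. q \<in> {1..n} \<and> card (component n C q) \<ge> 3} \<union>
     {component n C q | q. q \<in> {1..n} \<and> card (component n C q) = 2} \<union>
     ({{q \<in> {1..n}. card (component n C q) = 1}} - {{}})"

definition Sn_fix :: "nat \<Rightarrow> nat set list \<Rightarrow> (nat \<Rightarrow> nat) set" where
  "Sn_fix n C = {a \<in> Sn n. \<forall>S\<in>fixing_pattern n C. a ` S = S}"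

definition Aut_coup :: "nat \<Rightarrow> nat set set \<Rightarrow> (nat \<Rightarrow> nat) set" where
  "Aut_coup n E = {b \<in> Sn n. \<forall>i\<in>{1..n}. \<forall>j\<in>{1..n}. {b i, b j} \<in> E \<longleftrightarrow> {i, j} \<in> E}"

definition GX :: "nat \<Rightarrow> nat set set \<Rightarrow> nat set list \<Rightarrow> (vertex \<Rightarrow> vertex) monoid" where
  "GX n E C = (BijGroup (verts (X n E C)))
     \<lparr>carrier := {\<phi> \<in> Bij (verts (X n E C)).
        (\<forall>u\<in>verts (X n E C). \<forall>v\<in>verts (X n E C).
           (\<phi> u, \<phi> v) \<in> arcs (X n E C) \<longleftrightarrow> (u, v) \<in> arcs (X n E C)) \<and>
        \<phi> Src = Src \<and> \<phi> Snk = Snk \<and>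
        (\<exists>a\<in>Sn_fix n C. \<exists>b\<in>Aut_coup n E. \<forall>k\<in>{1..length C}. \<forall>\<tau>\<in>Sn n.
           \<phi> (Copy k \<tau>) = Copy k (a \<circ> \<tau> \<circ> inv' b))}\<rparr>"

definition arc_action ::
  "nat \<Rightarrow> nat set set \<Rightarrow> nat set list \<Rightarrow> (vertex \<Rightarrow> vertex) \<Rightarrow> arc \<Rightarrow> arc" where
  "arc_action n E C \<phi> = restrict (map_prod \<phi> \<phi>) (arcs (X n E C))"

definition V_orbits :: "nat \<Rightarrow> nat set set \<Rightarrow> nat set list \<Rightarrow> nat \<Rightarrow> vertex set set" where
  "V_orbits n E C k = orbits (GX n E C) (layer n k) (\<lambda>\<phi>. \<phi>)"

definition A_orbitals :: "nat \<Rightarrow> nat set set \<Rightarrow> nat set list \<Rightarrow> nat \<Rightarrow> arc set set" where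
  "A_orbitals n E C k = orbits (GX n E C) (A_arcs n E k) (arc_action n E C)"

definition D_orbitals :: "nat \<Rightarrow> nat set set \<Rightarrow> nat set list \<Rightarrow> nat \<Rightarrow> arc set set" where
  "D_orbitals n E C k = orbits (GX n E C) (D_arcs n E C k) (arc_action n E C)"

text \<open>The number of arcs of an orbital leaving (entering) any vertex at which one of its arcs
  starts (ends).\<close>

definition out_deg :: "arc set \<Rightarrow> nat" where
  "out_deg W = (THE d. \<forall>v\<in>fst ` W. card {e \<in> W. fst e = v} = d)"

definition in_deg :: "arc set \<Rightarrow> nat" where
  "in_deg W = (THE d. \<forall>v\<in>snd ` W. card {e \<in> W. snd e = v} = d)"

definition quotient_graph ::
  "nat \<Rightarrow> nat set set \<Rightarrow> nat set list \<Rightarrow> (vertex set, arc set) pre_digraph" where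
  "quotient_graph n E C =
     \<lparr>verts = orbits (GX n E C) (verts (X n E C)) (\<lambda>\<phi>. \<phi>),
      arcs = orbits (GX n E C) (arcs (X n E C)) (arc_action n E C),
      tail = (\<lambda>i. THE U. U \<in> orbits (GX n E C) (verts (X n E C)) (\<lambda>\<phi>. \<phi>) \<and> fst ` i \<subseteq> U),
      head = (\<lambda>i. THE U. U \<in> orbits (GX n E C) (verts (X n E C)) (\<lambda>\<phi>. \<phi>) \<and> snd ` i \<subseteq> U)\<rparr>"


section \<open>The reduced linear program (RSPP)\<close>

text \<open>Orbitals of different arc families are different sets, so the variables are indexed by
  the orbitals alone.\<close>

definition rspp_cost ::
  "nat \<Rightarrow> nat set set \<Rightarrow> nat set list \<Rightarrow> (arc set \<Rightarrow> real) \<times> (arc set \<Rightarrow> real) \<Rightarrow> real" where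
  "rspp_cost n E C = (\<lambda>(lam, \<theta>).
     \<Sum>k=1..length C. \<Sum>i\<in>A_orbitals n E C k. real (card i) * lam i)"

definition rspp_source :: "nat \<Rightarrow> nat set set \<Rightarrow> nat set list \<Rightarrow> (arc set \<Rightarrow> real) \<Rightarrow> real" where
  "rspp_source n E C \<theta> = (\<Sum>i\<in>D_orbitals n E C 0. real (out_deg i) * \<theta> i)"

definition rspp_sink :: "nat \<Rightarrow> nat set set \<Rightarrow> nat set list \<Rightarrow> (arc set \<Rightarrow> real) \<Rightarrow> real" where
  "rspp_sink n E C \<theta> = (\<Sum>i\<in>D_orbitals n E C (length C). real (in_deg i) * \<theta> i)"

definition rspp_in ::
  "nat \<Rightarrow> nat set set \<Rightarrow> nat set list \<Rightarrow>
   (arc set \<Rightarrow> real) \<Rightarrow> (arc set \<Rightarrow> real) \<Rightarrow> nat \<Rightarrow> vertex set \<Rightarrow> real" where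
  "rspp_in n E C lam \<theta> k u =
     (\<Sum>i\<in>in_arcs (quotient_graph n E C) u \<inter> D_orbitals n E C (k - 1). \<theta> i) +
     (\<Sum>i\<in>in_arcs (quotient_graph n E C) u \<inter> A_orbitals n E C k. real (in_deg i) * lam i)"

definition rspp_out ::
  "nat \<Rightarrow> nat set set \<Rightarrow> nat set list \<Rightarrow>
   (arc set \<Rightarrow> real) \<Rightarrow> (arc set \<Rightarrow> real) \<Rightarrow> nat \<Rightarrow> vertex set \<Rightarrow> real" where
  "rspp_out n E C lam \<theta> k u =
     (\<Sum>i\<in>out_arcs (quotient_graph n E C) u \<inter> D_orbitals n E C k. \<theta> i) +
     (\<Sum>i\<in>out_arcs (quotient_graph n E C) u \<inter> A_orbitals n E C k. real (out_deg i) * lam i)"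

definition rspp_feasible ::
  "nat \<Rightarrow> nat set set \<Rightarrow> nat set list \<Rightarrow> (arc set \<Rightarrow> real) \<times> (arc set \<Rightarrow> real) \<Rightarrow> bool" where
  "rspp_feasible n E C = (\<lambda>(lam, \<theta>).
     rspp_source n E C \<theta> = 1 \<and>
     rspp_sink n E C \<theta> = 1 \<and>
     (\<forall>k\<in>{1..length C}. \<forall>u\<in>V_orbits n E C k.
        rspp_in n E C lam \<theta> k u = rspp_out n E C lam \<theta> k u) \<and>
     (\<forall>k\<in>{1..length C}. \<forall>i\<in>A_orbitals n E C k. 0 \<le> lam i \<and> lam i \<le> 1) \<and>
     (\<forall>k\<in>{0..length C}. \<forall>i\<in>D_orbitals n E C k. 0 \<le> \<theta> i \<and> \<theta> i \<le> 1))"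

definition orbital_subst ::
  "nat \<Rightarrow> nat set set \<Rightarrow> nat set list \<Rightarrow>
   (arc set \<Rightarrow> real) \<times> (arc set \<Rightarrow> real) \<Rightarrow> (arc \<Rightarrow> real) \<times> (arc \<Rightarrow> real) \<Rightarrow> bool" where
  "orbital_subst n E C = (\<lambda>(lam, \<theta>) (x, y).
     (\<forall>k\<in>{1..length C}. \<forall>W\<in>A_orbitals n E C k. \<forall>e\<in>W. x e = lam W) \<and>
     (\<forall>k\<in>{0..length C}. \<forall>Z\<in>D_orbitals n E C k. \<forall>e\<in>Z. y e = \<theta> Z))"


section \<open>Minimum cost generalized network flow and (GNFP)\<close>

definition generalized_network ::
  "('v, 'e) pre_digraph \<Rightarrow> 'v \<Rightarrow> 'v \<Rightarrow> ('e \<Rightarrow> real) \<Rightarrow> ('e \<Rightarrow> real) \<Rightarrow> bool" where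
  "generalized_network G s t u p \<longleftrightarrow>
     fin_digraph G \<and> s \<in> verts G \<and> t \<in> verts G \<and> s \<noteq> t \<and>
     (\<forall>i\<in>arcs G. 0 \<le> u i \<and> 0 < p i)"

definition gnf_cost :: "('v, 'e) pre_digraph \<Rightarrow> ('e \<Rightarrow> real) \<Rightarrow> ('e \<Rightarrow> real) \<Rightarrow> real" where
  "gnf_cost G w f = (\<Sum>i\<in>arcs G. w i * f i)"

definition gnf_feasible ::
  "('v, 'e) pre_digraph \<Rightarrow> 'v \<Rightarrow> 'v \<Rightarrow> ('e \<Rightarrow> real) \<Rightarrow> ('e \<Rightarrow> real) \<Rightarrow> ('e \<Rightarrow> real) \<Rightarrow> bool" where
  "gnf_feasible G s t u p f \<longleftrightarrow>
     (\<Sum>i\<in>out_arcs G s. f i) = 1 \<and>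
     (\<Sum>i\<in>in_arcs G t. p i * f i) = 1 \<and>
     (\<forall>v\<in>verts G - {s, t}. (\<Sum>i\<in>out_arcs G v. f i) = (\<Sum>i\<in>in_arcs G v. p i * f i)) \<and>
     (\<forall>i\<in>arcs G. 0 \<le> f i \<and> f i \<le> u i)"

definition gnfp_w :: "nat \<Rightarrow> nat set set \<Rightarrow> nat set list \<Rightarrow> arc set \<Rightarrow> real" where
  "gnfp_w n E C i =
     (if i \<in> (\<Union>k\<in>{1..length C}. A_orbitals n E C k) then real (card i) / real (out_deg i) else 0)"

definition gnfp_u :: "nat \<Rightarrow> nat set set \<Rightarrow> nat set list \<Rightarrow> arc set \<Rightarrow> real" where
  "gnfp_u n E C i =
     (if i \<in> (\<Union>k\<in>{1..length C}. D_orbitals n E C k) then 1 else real (out_deg i))"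

text \<open>The multiplier on the orbitals leaving the source has to be \<open>1 / d\<^sup>+\<close> (which is also
  \<open>d\<^sup>- / d\<^sup>+\<close>, as for the orbitals \<open>W\<close>): the flow \<open>f = d\<^sup>+ * \<theta>\<close> leaving the source on
  such an orbital is spread over \<open>d\<^sup>+\<close> vertices, each of which receives \<open>\<theta> = f / d\<^sup>+\<close>.  With
  multiplier 1 there, the program would be infeasible unless the symmetry group is trivial.\<close>

definition gnfp_p :: "nat \<Rightarrow> nat set set \<Rightarrow> nat set list \<Rightarrow> arc set \<Rightarrow> real" where
  "gnfp_p n E C i =
     (if i \<in> (\<Union>k\<in>{1..length C}. A_orbitals n E C k) then real (in_deg i) / real (out_deg i)
      else if i \<in> D_orbitals n E C (length C) then real (in_deg i)
      else if i \<in> D_orbitals n E C 0 then 1 / real (out_deg i)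
      else 1)"

definition gnfp_cost :: "nat \<Rightarrow> nat set set \<Rightarrow> nat set list \<Rightarrow> (arc set \<Rightarrow> real) \<Rightarrow> real" where
  "gnfp_cost n E C = gnf_cost (quotient_graph n E C) (gnfp_w n E C)"

definition gnfp_feasible :: "nat \<Rightarrow> nat set set \<Rightarrow> nat set list \<Rightarrow> (arc set \<Rightarrow> real) \<Rightarrow> bool" where
  "gnfp_feasible n E C =
     gnf_feasible (quotient_graph n E C) {Src} {Snk} (gnfp_u n E C) (gnfp_p n E C)"

definition flow_subst ::
  "nat \<Rightarrow> nat set set \<Rightarrow> nat set list \<Rightarrow>
   (arc set \<Rightarrow> real) \<times> (arc set \<Rightarrow> real) \<Rightarrow> (arc set \<Rightarrow> real) \<Rightarrow> bool" where
  "flow_subst n E C = (\<lambda>(lam, \<theta>) f.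
     (\<forall>Z\<in>D_orbitals n E C 0. f Z = real (out_deg Z) * \<theta> Z) \<and>
     (\<forall>k\<in>{1..length C}. \<forall>Z\<in>D_orbitals n E C k. f Z = \<theta> Z) \<and>
     (\<forall>k\<in>{1..length C}. \<forall>W\<in>A_orbitals n E C k. f W = real (out_deg W) * lam W))"

end

theory Submission
  imports Defs "Graph_Theory.Shortest_Path"
begin

text \<open>
  The three programs attain the same set of costs, and this is a statement about a group acting on
  a digraph.  The elements of \<open>GX\<close> are automorphisms of \<open>X\<close>, hence all vertices
  of an orbit meet an orbital in equally many arcs (\<open>card_fibre\<close>).  If a solution of (SPP)
  is constant on orbitals, its conservation constraint at a vertex is therefore a weighted sum over
  the orbitals that touch the orbit of this vertex (\<open>sum_fibre\<close>), and this is the constraint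
  of (RSPP).  So the solutions of (RSPP) are exactly the symmetric solutions of (SPP).

  Symmetric solutions suffice because (SPP) is linear: averaging an arbitrary solution over each
  orbital keeps the cost, and the constraint of (RSPP) at an orbit is the sum of the constraints of
  (SPP) at its vertices, divided by the size of the orbit (\<open>sum_orbit\<close>,
  \<open>average_feasible\<close>).  The double count \<open>card_orbital\<close> produces the right
  coefficients here.

  (GNFP) is (RSPP) in other units: \<open>f = d\<^sup>+ * lam\<close> is what an orbital takes out of
  one vertex of the orbit at which it starts, and \<open>p * f = d\<^sup>- * lam\<close> is what it
  brings to one vertex of the orbit at which it ends.  Each variable is rescaled by a positive
  factor, so constraints, bounds and costs translate term by term.

  Finally, (SPP) has the length of a shortest path as its optimal value.  The indicator of a path
  is a feasible solution.  Conversely, the distance to the sink is a feasible dual solution and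
  bounds the cost of every unit flow from below (\<open>unit_flow_cost_ge\<close>).  The distances are
  finite since every vertex reaches the sink: in a connected coupling graph, swaps along a path
  bring the two qubits of the next gate together (\<open>gate_reachable\<close>).
\<close>

section \<open>Orbits and equivariant maps\<close>

context group_action
begin

lemma orbit_subset: "x \<in> E \<Longrightarrow> orbit G \<phi> x \<subseteq> E"
  by (auto simp: orbit_def intro: element_image)

lemma orbit_eq:
  assumes "x \<in> E" "y \<in> orbit G \<phi> x"
  shows "orbit G \<phi> y = orbit G \<phi> x"
proof -
  have y: "y \<in> E" using assms orbit_subset by blast
  have "x \<in> orbit G \<phi> y" using orbit_sym[OF assms(1) y assms(2)] .
  then show ?thesis
    using orbit_trans assms y orbit_subset by blast
qed

lemma orbits_memD:
  assumes "W \<in> orbits G E \<phi>" "x \<in> W"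
  shows "x \<in> E" "W = orbit G \<phi> x"
proof -
  obtain y where y: "y \<in> E" "W = orbit G \<phi> y" using assms(1) by (auto simp: orbits_def)
  show "x \<in> E" using orbit_subset[OF y(1)] y(2) assms(2) by blast
  show "W = orbit G \<phi> x" using orbit_eq[OF y(1), of x] y(2) assms(2) by simp
qed

lemma orbits_nonempty: "W \<in> orbits G E \<phi> \<Longrightarrow> W \<noteq> {}"
  using orbit_refl by (auto simp: orbits_def)

end

text \<open>
  The common generalization of \<open>out_deg\<close> and \<open>in_deg\<close>.  With an arbitrary
  endpoint map \<open>pr\<close> in place of \<open>fst\<close> and \<open>snd\<close>, every fact about
  degrees is proved once and used for both.
\<close>

definition fibre_size :: "('e \<Rightarrow> 'v) \<Rightarrow> 'e set \<Rightarrow> nat" where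
  "fibre_size pr W = (THE d. \<forall>v\<in>pr ` W. card {e \<in> W. pr e = v} = d)"

lemma out_deg_eq_fibre_size: "out_deg = fibre_size fst"
  and in_deg_eq_fibre_size: "in_deg = fibre_size snd"
  by (auto simp: out_deg_def in_deg_def fibre_size_def)

locale equivariant_map =
  A: group_action G S \<alpha> + B: group_action G V \<beta>
  for G (structure) and S :: "'e set" and \<alpha> and V :: "'v set" and \<beta> +
  fixes pr :: "'e \<Rightarrow> 'v"
  assumes finite_S: "finite S"
    and pr_mem: "e \<in> S \<Longrightarrow> pr e \<in> V"
    and equivariant: "g \<in> carrier G \<Longrightarrow> e \<in> S \<Longrightarrow> pr (\<alpha> g e) = \<beta> g (pr e)"
begin

lemma image_orbit: "e \<in> S \<Longrightarrow> pr ` orbit G \<alpha> e = orbit G \<beta> (pr e)"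
  by (force simp: orbit_def equivariant)

lemma image_orbital:
  assumes "W \<in> orbits G S \<alpha>" "e \<in> W"
  shows "pr ` W = orbit G \<beta> (pr e)"
  using image_orbit[OF A.orbits_memD(1)[OF assms]] A.orbits_memD(2)[OF assms] by simp

lemma image_orbital_mem:
  assumes "W \<in> orbits G S \<alpha>"
  shows "pr ` W \<in> orbits G V \<beta>"
proof -
  obtain e where e: "e \<in> W" using A.orbits_nonempty[OF assms] by blast
  then have "pr e \<in> V" using A.orbits_memD(1)[OF assms] pr_mem by blast
  then show ?thesis unfolding image_orbital[OF assms e] orbits_def[of G V] by blast
qed

lemma image_orbital_eq_iff:
  assumes "W \<in> orbits G S \<alpha>" "v \<in> V"
  shows "pr ` W = orbit G \<beta> v \<longleftrightarrow> v \<in> pr ` W"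
  using image_orbital[OF assms(1)] B.orbit_refl[OF assms(2)] by (metis imageE)

text \<open>
  This evaluates the definite descriptions behind the tails and heads of the quotient graph.
\<close>

lemma the_orbit_of_image:
  assumes "W \<in> orbits G S \<alpha>"
  shows "(THE U. U \<in> orbits G V \<beta> \<and> pr ` W \<subseteq> U) = pr ` W"
proof (rule the_equality)
  fix U assume "U \<in> orbits G V \<beta> \<and> pr ` W \<subseteq> U"
  then show "U = pr ` W"
    using B.disjoint_union[OF _ image_orbital_mem[OF assms]] A.orbits_nonempty[OF assms]
    by fastforce
qed (use image_orbital_mem[OF assms] in auto)

lemma finite_orbital: "W \<in> orbits G S \<alpha> \<Longrightarrow> finite W"
  using A.orbits_memD(1) finite_S by (metis finite_subset subsetI)

text \<open>
  A group element that moves \<open>v\<close> to \<open>v'\<close> maps the fibre over \<open>v\<close>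
  injectively into the fibre over \<open>v'\<close>, and it maps the orbital to itself.
\<close>

lemma card_fibre_le:
  assumes W: "W \<in> orbits G S \<alpha>" and v: "v \<in> pr ` W" and v': "v' \<in> pr ` W"
  shows "card {e \<in> W. pr e = v} \<le> card {e \<in> W. pr e = v'}"
proof -
  have V: "v \<in> V" using v W A.orbits_memD(1) pr_mem by blast
  have "v' \<in> orbit G \<beta> v" using v' image_orbital_eq_iff[OF W V] v by simp
  then obtain g where g: "g \<in> carrier G" "\<beta> g v = v'" by (auto simp: orbit_def)
  have sub: "W \<subseteq> S" using A.orbits_memD(1)[OF W] by blast
  have "inj_on (\<alpha> g) {e \<in> W. pr e = v}"
    using A.inj_prop[OF g(1)] sub by (auto intro: inj_on_subset)
  moreover have "\<alpha> g ` {e \<in> W. pr e = v} \<subseteq> {e \<in> W. pr e = v'}"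
    using g sub A.orbits_memD(2)[OF W] by (auto simp: equivariant orbit_def)
  moreover have "finite {e \<in> W. pr e = v'}" using finite_orbital[OF W] by simp
  ultimately show ?thesis by (rule card_inj_on_le)
qed

lemma card_fibre:
  assumes W: "W \<in> orbits G S \<alpha>" and v: "v \<in> pr ` W"
  shows "card {e \<in> W. pr e = v} = fibre_size pr W"
  unfolding fibre_size_def
proof (rule the_equality[symmetric])
  show "\<forall>v'\<in>pr ` W. card {e \<in> W. pr e = v'} = card {e \<in> W. pr e = v}"
    using card_fibre_le[OF W] v by (auto intro!: antisym)
qed (use v in auto)

lemma fibre_size_pos:
  assumes "W \<in> orbits G S \<alpha>"
  shows "0 < fibre_size pr W"
proof -
  obtain e where e: "e \<in> W" using A.orbits_nonempty[OF assms] by blast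
  then have "0 < card {e' \<in> W. pr e' = pr e}"
    using finite_orbital[OF assms] by (auto simp: card_gt_0_iff)
  then show ?thesis using card_fibre[OF assms, of "pr e"] e by simp
qed

lemma fibre_size_eq_1:
  assumes "W \<in> orbits G S \<alpha>" "inj_on pr W"
  shows "fibre_size pr W = 1"
proof -
  obtain e where e: "e \<in> W" using A.orbits_nonempty[OF assms(1)] by blast
  then have "{e' \<in> W. pr e' = pr e} = {e}" using assms(2) by (auto dest: inj_onD)
  then show ?thesis using card_fibre[OF assms(1), of "pr e"] e by simp
qed

lemma card_orbital:
  assumes "W \<in> orbits G S \<alpha>"
  shows "card W = card (pr ` W) * fibre_size pr W"
proof -
  have "card W = (\<Sum>v\<in>pr ` W. card {e \<in> W. pr e = v})"
    using sum.image_gen[OF finite_orbital[OF assms], of "\<lambda>_. 1::nat" pr] by simp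
  also have "\<dots> = (\<Sum>v\<in>pr ` W. fibre_size pr W)"
    by (intro sum.cong) (auto simp: card_fibre[OF assms])
  finally show ?thesis by simp
qed

end

text \<open>
  An invariant subset \<open>T\<close> of the arcs stands for one of the families
  \<open>A_arcs\<close> and \<open>D_arcs\<close>.  The action is still that on the full arc set, whose
  restriction to \<open>T\<close> is in general not a \<open>group_action\<close> on \<open>T\<close> since its
  values are extensional functions on the larger set.
\<close>

locale invariant_arcs = equivariant_map +
  fixes T
  assumes T_sub: "T \<subseteq> S"
    and T_invariant: "g \<in> carrier G \<Longrightarrow> e \<in> T \<Longrightarrow> \<alpha> g e \<in> T"
begin

lemma orbits_sub: "orbits G T \<alpha> \<subseteq> orbits G S \<alpha>"
  using T_sub by (auto simp: orbits_def)

lemma mem_orbital_iff: "e \<in> T \<longleftrightarrow> (\<exists>W\<in>orbits G T \<alpha>. e \<in> W)"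
  using T_sub A.orbit_refl by (auto simp: orbits_def orbit_def[of G \<alpha>] T_invariant) blast+

lemma finite_orbitals: "finite (orbits G T \<alpha>)"
  using finite_S T_sub finite_subset[OF T_sub] by (auto simp: orbits_def Setcompr_eq_image)

lemma sum_orbitals:
  fixes f :: "_ \<Rightarrow> real"
  shows "(\<Sum>e\<in>{e\<in>T. P e}. f e) = (\<Sum>W\<in>orbits G T \<alpha>. \<Sum>e\<in>{e\<in>W. P e}. f e)"
proof -
  have "{e\<in>T. P e} = (\<Union>W\<in>orbits G T \<alpha>. {e\<in>W. P e})"
    using mem_orbital_iff by auto
  moreover have "{e\<in>W. P e} \<inter> {e\<in>W'. P e} = {}"
    if "W \<in> orbits G T \<alpha>" "W' \<in> orbits G T \<alpha>" "W \<noteq> W'" for W W'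
    using A.disjoint_union[of W W'] that orbits_sub by blast
  moreover have "finite {e\<in>W. P e}" if "W \<in> orbits G T \<alpha>" for W
    using that orbits_sub finite_orbital by auto
  ultimately show ?thesis
    using finite_orbitals by (simp add: sum.UNION_disjoint)
qed

text \<open>
  The heart of the substitution: orbitals whose image avoids \<open>v\<close> contribute nothing, and
  any other orbital has the orbit of \<open>v\<close> as its image and contributes its common value once
  for every arc in the fibre.
\<close>

lemma sum_fibre:
  fixes f :: "_ \<Rightarrow> real"
  assumes v: "v \<in> V" and f: "\<And>W e. W \<in> orbits G T \<alpha> \<Longrightarrow> e \<in> W \<Longrightarrow> f e = h W"
  shows "(\<Sum>e\<in>{e\<in>T. pr e = v}. f e) =
         (\<Sum>W\<in>{W\<in>orbits G T \<alpha>. pr ` W = orbit G \<beta> v}. real (fibre_size pr W) * h W)"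
proof -
  have *: "(\<Sum>e\<in>{e\<in>W. pr e = v}. f e) =
      (if pr ` W = orbit G \<beta> v then real (fibre_size pr W) * h W else 0)"
    if W: "W \<in> orbits G T \<alpha>" for W
  proof -
    have WS: "W \<in> orbits G S \<alpha>" using W orbits_sub by blast
    have "(\<Sum>e\<in>{e\<in>W. pr e = v}. f e) = real (card {e\<in>W. pr e = v}) * h W"
      using f[OF W] by simp
    moreover have "{e\<in>W. pr e = v} = {}" if "v \<notin> pr ` W" using that by auto
    ultimately show ?thesis
      using image_orbital_eq_iff[OF WS v] card_fibre[OF WS, of v] by (metis card.empty mult_zero_left of_nat_0)
  qed
  show ?thesis
    unfolding sum_orbitals using finite_orbitals by (simp add: * sum.inter_filter)
qed

text \<open>
  The heart of the averaging: an orbital lies over \<open>U\<close> either entirely or not at all, so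
  the left side adds up complete orbitals.  The double count of an orbital then turns its total into
  \<open>card U\<close> times its degree times its mean value.
\<close>

lemma sum_orbit:
  fixes f :: "_ \<Rightarrow> real"
  assumes U: "U \<in> orbits G V \<beta>" and "finite U"
  shows "(\<Sum>v\<in>U. \<Sum>e\<in>{e\<in>T. pr e = v}. f e) = real (card U) *
         (\<Sum>W\<in>{W\<in>orbits G T \<alpha>. pr ` W = U}. real (fibre_size pr W) * (sum f W / real (card W)))"
proof -
  have fin: "finite {e\<in>T. pr e \<in> U}" using finite_S T_sub by (auto intro: finite_subset)
  have *: "(\<Sum>e\<in>{e\<in>W. pr e \<in> U}. f e) = (if pr ` W = U then sum f W else 0)"
    if W: "W \<in> orbits G T \<alpha>" for W
  proof -
    have WS: "W \<in> orbits G S \<alpha>" using W orbits_sub by blast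
    have "{e\<in>W. pr e \<in> U} = (if pr ` W = U then W else {})"
      using B.disjoint_union[OF U image_orbital_mem[OF WS]] by auto
    then show ?thesis by simp
  qed
  have "(\<Sum>v\<in>U. \<Sum>e\<in>{e\<in>T. pr e = v}. f e) = (\<Sum>v\<in>U. sum f {e \<in> {e\<in>T. pr e \<in> U}. pr e = v})"
    by (intro sum.cong) auto
  also have "\<dots> = (\<Sum>e\<in>{e\<in>T. pr e \<in> U}. f e)"
    using fin assms(2) by (intro sum.group) auto
  also have "\<dots> = (\<Sum>W\<in>{W\<in>orbits G T \<alpha>. pr ` W = U}. sum f W)"
    unfolding sum_orbitals using finite_orbitals by (simp add: * sum.inter_filter)
  also have "\<dots> = (\<Sum>W\<in>{W\<in>orbits G T \<alpha>. pr ` W = U}.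
      real (card U) * (real (fibre_size pr W) * (sum f W / real (card W))))"
  proof (rule sum.cong[OF refl])
    fix W assume "W \<in> {W\<in>orbits G T \<alpha>. pr ` W = U}"
    then have W: "W \<in> orbits G S \<alpha>" "pr ` W = U" using orbits_sub by auto
    have "real (card W) = real (card U) * real (fibre_size pr W)"
      using card_orbital[OF W(1)] W(2) by simp
    moreover have "card W \<noteq> 0" using finite_orbital A.orbits_nonempty W(1) by (simp add: card_eq_0_iff)
    ultimately show "sum f W = real (card U) * (real (fibre_size pr W) * (sum f W / real (card W)))"
      by (metis (no_types, opaque_lifting) mult.assoc nonzero_mult_div_cancel_left of_nat_eq_0_iff
          times_divide_eq_right)
  qed
  finally show ?thesis by (simp add: sum_distrib_left)
qed

end

section \<open>Shortest paths and unit flows\<close>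

context fin_digraph
begin

text \<open>
  Adding an indicator on each side states the conservation constraint at ordinary vertices, at the
  source and at the sink by a single equation.
\<close>

definition unit_flow :: "('b \<Rightarrow> real) \<Rightarrow> 'a \<Rightarrow> 'a \<Rightarrow> bool" where
  "unit_flow z s t \<longleftrightarrow> (\<forall>e\<in>arcs G. 0 \<le> z e) \<and>
     (\<forall>v\<in>verts G. sum z (out_arcs G v) + of_bool (v = t) = sum z (in_arcs G v) + of_bool (v = s))"

lemma sum_by_endpoint:
  fixes f :: "'b \<Rightarrow> real"
  shows "(\<Sum>e\<in>arcs G. h (tail G e) * f e) = (\<Sum>v\<in>verts G. h v * sum f (out_arcs G v))"
    and "(\<Sum>e\<in>arcs G. h (head G e) * f e) = (\<Sum>v\<in>verts G. h v * sum f (in_arcs G v))"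
proof -
  have "(\<Sum>v\<in>verts G. sum (\<lambda>e. h (tail G e) * f e) {e \<in> arcs G. tail G e = v}) =
      (\<Sum>e\<in>arcs G. h (tail G e) * f e)"
    by (rule sum.group) auto
  then show "(\<Sum>e\<in>arcs G. h (tail G e) * f e) = (\<Sum>v\<in>verts G. h v * sum f (out_arcs G v))"
    by (simp add: sum_distrib_left out_arcs_def)
  have "(\<Sum>v\<in>verts G. sum (\<lambda>e. h (head G e) * f e) {e \<in> arcs G. head G e = v}) =
      (\<Sum>e\<in>arcs G. h (head G e) * f e)"
    by (rule sum.group) auto
  then show "(\<Sum>e\<in>arcs G. h (head G e) * f e) = (\<Sum>v\<in>verts G. h v * sum f (in_arcs G v))"
    by (simp add: sum_distrib_left in_arcs_def)
qed

text \<open>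
  Weak duality: the potential drop along the arcs is bounded by the cost, and summation by parts
  turns the total potential drop of a unit flow into \<open>h s - h t\<close>.
\<close>

lemma unit_flow_cost_ge:
  assumes z: "unit_flow z s t" and st: "s \<in> verts G" "t \<in> verts G"
    and pot: "\<And>e. e \<in> arcs G \<Longrightarrow> h (tail G e) \<le> c e + h (head G e)"
  shows "h s - h t \<le> (\<Sum>e\<in>arcs G. c e * z e)"
proof -
  have "(\<Sum>v\<in>verts G. h v * (sum z (out_arcs G v) - sum z (in_arcs G v))) =
      (\<Sum>v\<in>verts G. h v * of_bool (v = s) - h v * of_bool (v = t))"
  proof (rule sum.cong[OF refl])
    fix v assume "v \<in> verts G"
    then have "sum z (out_arcs G v) - sum z (in_arcs G v) = of_bool (v = s) - of_bool (v = t)"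
      using z by (fastforce simp: unit_flow_def)
    then show "h v * (sum z (out_arcs G v) - sum z (in_arcs G v)) =
        h v * of_bool (v = s) - h v * of_bool (v = t)"
      by (simp add: right_diff_distrib)
  qed
  also have "\<dots> = h s - h t"
    using st by (simp add: sum_subtractf of_bool_def if_distrib[of "(*) _"] cong: if_cong)
  finally have "h s - h t = (\<Sum>e\<in>arcs G. (h (tail G e) - h (head G e)) * z e)"
    using sum_by_endpoint[of h z] by (simp add: left_diff_distrib right_diff_distrib sum_subtractf)
  also have "\<dots> \<le> (\<Sum>e\<in>arcs G. c e * z e)"
    using z pot by (intro sum_mono mult_right_mono) (auto simp: unit_flow_def diff_le_eq)
  finally show ?thesis .
qed

text \<open>
  Counting arcs with multiplicity makes the statement hold for all walks, and so it can be proved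
  by induction on the walk.
\<close>

lemma awalk_count_conservation:
  assumes "awalk u p v" "w \<in> verts G"
  shows "(\<Sum>e\<in>out_arcs G w. real (count_list p e)) + of_bool (w = v) =
         (\<Sum>e\<in>in_arcs G w. real (count_list p e)) + of_bool (w = u)"
  using assms(1)
proof (induction p arbitrary: u)
  case Nil
  then show ?case by (simp add: awalk_Nil_iff)
next
  case (Cons a p)
  have a: "a \<in> arcs G" "u = tail G a" and p: "awalk (head G a) p v"
    using Cons.prems by (auto simp: awalk_Cons_iff)
  have count: "real (count_list (a # p) e) = real (count_list p e) + of_bool (e = a)" for e
    by simp
  have "(\<Sum>e\<in>out_arcs G w. of_bool (e = a)) = (of_bool (w = u) :: real)"
    using a finite_out_arcs by (auto simp: of_bool_def)
  moreover have "(\<Sum>e\<in>in_arcs G w. of_bool (e = a)) = (of_bool (w = head G a) :: real)"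
    using a finite_in_arcs by (auto simp: of_bool_def)
  ultimately show ?case
    using Cons.IH[OF p] unfolding count sum.distrib by linarith
qed

lemma apath_distinct: "apath u p v \<Longrightarrow> distinct p"
  by (auto simp: apath_def awalk_verts_conv distinct_map split: if_splits)

lemma unit_flow_apath:
  assumes "apath s p t"
  shows "unit_flow (\<lambda>e. of_bool (e \<in> set p)) s t"
    and "(\<Sum>e\<in>arcs G. c e * of_bool (e \<in> set p)) = awalk_cost c p"
proof -
  have p: "distinct p" "awalk s p t"
    using assms apath_distinct by (auto simp: apath_def)
  have count: "real (count_list p e) = of_bool (e \<in> set p)" for e
    using p(1) by (induction p) (auto simp: count_list_0_iff)
  show "unit_flow (\<lambda>e. of_bool (e \<in> set p)) s t"
    using awalk_count_conservation[OF p(2)] unfolding count unit_flow_def by simp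
  have "(\<Sum>e\<in>arcs G. c e * of_bool (e \<in> set p)) = (\<Sum>e\<in>arcs G \<inter> set p. c e)"
    by (simp add: sum.inter_restrict of_bool_def if_distrib[of "(*) _"] cong: if_cong)
  also have "arcs G \<inter> set p = set p" using p(2) by (auto simp: awalk_def)
  also have "sum c (set p) = awalk_cost c p"
    using p(1) by (simp add: awalk_cost_def sum_list_distinct_conv_sum_set)
  finally show "(\<Sum>e\<in>arcs G. c e * of_bool (e \<in> set p)) = awalk_cost c p" .
qed

text \<open>
  The potential is the distance to \<open>t\<close>.  Reachability of \<open>t\<close> from every vertex
  makes it real-valued, and the triangle inequality makes it dual feasible.
\<close>

theorem shortest_path_optimal_unit_flow:
  assumes reach: "\<And>v. v \<in> verts G \<Longrightarrow> v \<rightarrow>\<^sup>* t"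
    and s: "s \<in> verts G" and t: "t \<in> verts G"
    and pos: "\<And>e. e \<in> arcs G \<Longrightarrow> 0 \<le> c e"
  shows "\<exists>p. is_arg_min (awalk_cost c) (\<lambda>p. apath s p t) p \<and>
    (\<forall>z. unit_flow z s t \<longrightarrow> awalk_cost c p \<le> (\<Sum>e\<in>arcs G. c e * z e))"
proof -
  have ex: "\<exists>p. apath v p t \<and> \<mu> c v t = awalk_cost c p" if "v \<in> verts G" for v
    using min_cost_awalk[OF reach[OF that], of c] pos by blast
  define h where "h v = real_of_ereal (\<mu> c v t)" for v
  have h: "h v \<le> awalk_cost c p" if "awalk v p t" for v p
  proof -
    have "v \<in> verts G" using that by (rule awalk_hd_in_verts)
    then obtain q where "\<mu> c v t = ereal (awalk_cost c q)" using ex by blast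
    then show ?thesis using min_cost_le_walk_cost[OF that, of c] by (simp add: h_def)
  qed
  have ex: "\<exists>p. apath v p t \<and> h v = awalk_cost c p" if "v \<in> verts G" for v
    using ex[OF that] by (auto simp: h_def)
  have pot: "h (tail G e) \<le> c e + h (head G e)" if e: "e \<in> arcs G" for e
  proof -
    obtain p where "apath (head G e) p t" "h (head G e) = awalk_cost c p"
      using ex[of "head G e"] e by auto
    then show ?thesis using h[of "tail G e" "e # p"] e by (auto simp: awalk_Cons_iff apath_def)
  qed
  have ht: "h t = 0"
  proof (rule antisym)
    show "h t \<le> 0" using h[of t "[]"] t by (simp add: awalk_Nil_iff)
    obtain q where q: "awalk t q t" "h t = awalk_cost c q"
      using ex[OF t] by (auto simp: apath_def)
    show "0 \<le> h t" unfolding q(2) by (rule pos_cost_pos_awalk_cost[OF q(1) pos])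
  qed
  obtain p where p: "apath s p t" "h s = awalk_cost c p" using ex[OF s] by blast
  have "\<not> awalk_cost c q < awalk_cost c p" if "apath s q t" for q
    using h[OF awalkI_apath[OF that]] p(2) by simp
  then have "is_arg_min (awalk_cost c) (\<lambda>p. apath s p t) p"
    using p(1) by (auto simp: is_arg_min_def)
  moreover have "awalk_cost c p \<le> (\<Sum>e\<in>arcs G. c e * z e)" if "unit_flow z s t" for z
    using unit_flow_cost_ge[OF that s t pot] ht p(2) by simp
  ultimately show ?thesis by blast
qed

end

section \<open>The layered digraph\<close>

locale routing =
  fixes n :: nat and E :: "nat set set" and C :: "nat set list"
  assumes coupling: "coupling_graph n E" and circuit: "circuit n C" and gates: "1 \<le> length C"
begin

text \<open>
  Levels separate the arc families: arcs in \<open>A_arcs n E k\<close> stay at level \<open>k\<close>,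
  those in \<open>D_arcs n E C k\<close> lead from level \<open>k\<close> to level \<open>k + 1\<close>.
  With the source at level 0 and the sink above the last gate, this covers the first and the last
  family without exceptions.  Symmetries preserve levels, hence also the families.
\<close>

definition level :: "vertex \<Rightarrow> nat" where
  "level v = (case v of Src \<Rightarrow> 0 | Snk \<Rightarrow> Suc (length C) | Copy k \<tau> \<Rightarrow> k)"

lemma level_simps [simp]:
  "level Src = 0" "level Snk = Suc (length C)" "level (Copy k \<tau>) = k"
  by (simp_all add: level_def)

lemma finite_Sn: "finite (Sn n)"
  by (simp add: sym_group_def finite_permutations)

lemma comp_mem_Sn: "\<sigma> \<in> Sn n \<Longrightarrow> \<tau> \<in> Sn n \<Longrightarrow> \<sigma> \<circ> \<tau> \<in> Sn n"
  by (simp add: sym_group_def permutes_compose)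

lemma inv_mem_Sn: "\<sigma> \<in> Sn n \<Longrightarrow> inv' \<sigma> \<in> Sn n"
  by (simp add: sym_group_def permutes_inv)

lemma swaps_sub: "swaps E \<subseteq> Sn n"
proof
  fix \<sigma> assume "\<sigma> \<in> swaps E"
  then obtain i j where "\<sigma> = transpose i j" "{i, j} \<in> E" by (auto simp: swaps_def)
  moreover from this have "{i, j} \<subseteq> {1..n}" using coupling unfolding coupling_graph_def by blast
  ultimately show "\<sigma> \<in> Sn n" by (simp add: sym_group_def permutes_swap_id)
qed

lemma gate_perms_sub: "gate_perms n E C k \<subseteq> Sn n"
  by (auto simp: gate_perms_def)

lemma verts_X: "verts (X n E C) = {Src, Snk} \<union> (\<Union>k\<in>{1..length C}. Copy k ` Sn n)"
  by (simp add: X_def layer_def)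

lemma tail_X [simp]: "tail (X n E C) = fst" and head_X [simp]: "head (X n E C) = snd"
  by (simp_all add: X_def)

lemma Src_verts [simp]: "Src \<in> verts (X n E C)" and Snk_verts [simp]: "Snk \<in> verts (X n E C)"
  and Copy_verts [simp]: "Copy k \<tau> \<in> verts (X n E C) \<longleftrightarrow> k \<in> {1..length C} \<and> \<tau> \<in> Sn n"
  by (auto simp: verts_X)

lemma A_arcs_endpoints:
  "e \<in> A_arcs n E k \<Longrightarrow> k \<in> {1..length C} \<Longrightarrow>
     fst e \<in> verts (X n E C) \<and> snd e \<in> verts (X n E C) \<and> level (fst e) = k \<and> level (snd e) = k"
  using swaps_sub comp_mem_Sn by (auto simp: A_arcs_def)

lemma D_arcs_endpoints:
  "e \<in> D_arcs n E C k \<Longrightarrow> k \<le> length C \<Longrightarrow>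
     fst e \<in> verts (X n E C) \<and> snd e \<in> verts (X n E C) \<and> level (fst e) = k \<and> level (snd e) = Suc k"
  using gates by (auto simp: D_arcs_def Suc_le_eq dest: gate_perms_sub[THEN subsetD] split: if_splits)

lemma arcs_X_cases:
  assumes "e \<in> arcs (X n E C)"
  obtains (A) k where "k \<in> {1..length C}" "e \<in> A_arcs n E k"
    | (D) k where "k \<le> length C" "e \<in> D_arcs n E C k"
  using assms by (auto simp: X_def)

lemma A_arcs_iff:
  assumes "k \<in> {1..length C}"
  shows "e \<in> A_arcs n E k \<longleftrightarrow> e \<in> arcs (X n E C) \<and> level (fst e) = k \<and> level (snd e) = k"
proof
  assume "e \<in> A_arcs n E k"
  then show "e \<in> arcs (X n E C) \<and> level (fst e) = k \<and> level (snd e) = k"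
    using A_arcs_endpoints[OF _ assms] assms by (auto simp: X_def)
next
  assume "e \<in> arcs (X n E C) \<and> level (fst e) = k \<and> level (snd e) = k"
  then show "e \<in> A_arcs n E k"
    by (auto elim!: arcs_X_cases dest: A_arcs_endpoints D_arcs_endpoints)
qed

lemma D_arcs_iff:
  assumes "k \<le> length C"
  shows "e \<in> D_arcs n E C k \<longleftrightarrow> e \<in> arcs (X n E C) \<and> level (fst e) = k \<and> level (snd e) = Suc k"
proof
  assume "e \<in> D_arcs n E C k"
  then show "e \<in> arcs (X n E C) \<and> level (fst e) = k \<and> level (snd e) = Suc k"
    using D_arcs_endpoints[OF _ assms] assms by (auto simp: X_def)
next
  assume "e \<in> arcs (X n E C) \<and> level (fst e) = k \<and> level (snd e) = Suc k"
  then show "e \<in> D_arcs n E C k"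
    by (auto elim!: arcs_X_cases dest: A_arcs_endpoints D_arcs_endpoints)
qed

lemma layer_iff:
  assumes "k \<in> {1..length C}"
  shows "v \<in> layer n k \<longleftrightarrow> v \<in> verts (X n E C) \<and> level v = k"
  using assms by (cases v) (auto simp: layer_def)

lemma endpoints_mem:
  assumes "e \<in> arcs (X n E C)"
  shows "fst e \<in> verts (X n E C)" "snd e \<in> verts (X n E C)"
  using assms A_arcs_endpoints[of e] D_arcs_endpoints[of e] by (auto elim!: arcs_X_cases)

lemma finite_verts_X: "finite (verts (X n E C))"
  using finite_Sn by (simp add: verts_X)

lemma fin_digraph_X: "fin_digraph (X n E C)"
proof
  have "arcs (X n E C) \<subseteq> verts (X n E C) \<times> verts (X n E C)"
    using endpoints_mem by (auto simp: mem_Times_iff)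
  then show "finite (arcs (X n E C))"
    by (rule finite_subset) (simp add: finite_verts_X)
qed (use endpoints_mem finite_verts_X in auto)

end

sublocale routing \<subseteq> X: fin_digraph "X n E C"
  by (rule fin_digraph_X)

context routing
begin

lemma adjI: "(u, v) \<in> arcs (X n E C) \<Longrightarrow> u \<rightarrow>\<^bsub>X n E C\<^esub> v"
  by (force simp: arcs_ends_def arc_to_ends_def)

text \<open>
  \<open>p\<close> and \<open>q\<close> are the positions of the two qubits of the gate.  Moving the first
  qubit step by step along a path from \<open>p\<close> to \<open>q\<close> leaves the second one in place
  until the two are adjacent.
\<close>

lemma gate_reachable:
  assumes path: "(p, q) \<in> {(u, v). {u, v} \<in> E}\<^sup>*" and "p \<noteq> q"
    and k: "k \<in> {1..length C}" and gate: "C ! (k - 1) = {\<tau> p, \<tau> q}" and \<tau>: "\<tau> \<in> Sn n"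
  shows "\<exists>\<tau>'\<in>gate_perms n E C k. Copy k \<tau> \<rightarrow>\<^sup>*\<^bsub>X n E C\<^esub> Copy k \<tau>'"
  using path \<open>p \<noteq> q\<close> gate \<tau>
proof (induction arbitrary: \<tau> rule: converse_rtrancl_induct)
  case (step p r)
  have pr: "{p, r} \<in> E" using step.hyps(1) by simp
  have inj: "inj \<tau>" using step.prems(3) by (auto simp: sym_group_def permutes_inj)
  show ?case
  proof (cases "r = q")
    case True
    then have "\<tau> \<in> gate_perms n E C k"
      using step.prems pr inj by (simp add: gate_perms_def)
    moreover have "Copy k \<tau> \<rightarrow>\<^sup>*\<^bsub>X n E C\<^esub> Copy k \<tau>"
      using k step.prems(3) by (intro X.reachable_refl) simp
    ultimately show ?thesis by blast
  next
    case False
    \<comment> \<open>the swap moves the first qubit from p to r and fixes q, which differs from p and r\<close>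
    define \<tau>' where "\<tau>' = \<tau> \<circ> transpose p r"
    have swap: "transpose p r \<in> swaps E" using pr by (auto simp: swaps_def)
    have "\<tau>' \<in> Sn n"
      using comp_mem_Sn[OF step.prems(3)] swap swaps_sub by (auto simp: \<tau>'_def)
    moreover have "C ! (k - 1) = {\<tau>' r, \<tau>' q}"
      using step.prems False by (simp add: \<tau>'_def transpose_def)
    ultimately obtain \<rho> where \<rho>: "\<rho> \<in> gate_perms n E C k" "Copy k \<tau>' \<rightarrow>\<^sup>*\<^bsub>X n E C\<^esub> Copy k \<rho>"
      using step.IH False by blast
    have "(Copy k \<tau>, Copy k \<tau>') \<in> arcs (X n E C)"
      using k swap step.prems(3) by (auto simp: X_def A_arcs_def \<tau>'_def)
    then show ?thesis using \<rho> adjI X.adj_reachable_trans by blast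
  qed
qed simp

lemma next_gate:
  assumes k: "k \<in> {1..length C}" and \<tau>: "\<tau> \<in> Sn n"
  shows "\<exists>\<tau>'\<in>gate_perms n E C k. Copy k \<tau> \<rightarrow>\<^sup>*\<^bsub>X n E C\<^esub> Copy k \<tau>'"
proof -
  have perm: "\<tau> permutes {1..n}" using \<tau> by (simp add: sym_group_def)
  have "C ! (k - 1) \<in> set C" using k by (intro nth_mem) auto
  then obtain a b where ab: "C ! (k - 1) = {a, b}" "a \<noteq> b" "{a, b} \<subseteq> {1..n}"
    using circuit by (metis circuit_def card_2_iff)
  have "inv' \<tau> a \<in> {1..n}" "inv' \<tau> b \<in> {1..n}"
    using permutes_in_image[OF permutes_inv[OF perm]] ab(3) by auto
  then have "(inv' \<tau> a, inv' \<tau> b) \<in> {(u, v). {u, v} \<in> E}\<^sup>*"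
    using coupling by (simp add: coupling_graph_def)
  moreover have "inv' \<tau> a \<noteq> inv' \<tau> b"
    using ab(2) permutes_inverses(1)[OF perm] by metis
  ultimately show ?thesis
    using gate_reachable[of "inv' \<tau> a" "inv' \<tau> b" k \<tau>] k \<tau> ab(1)
    by (simp add: permutes_inverses[OF perm])
qed

lemma Copy_reaches_Snk:
  assumes "k \<in> {1..length C}" "\<tau> \<in> Sn n"
  shows "Copy k \<tau> \<rightarrow>\<^sup>*\<^bsub>X n E C\<^esub> Snk"
proof -
  have "1 \<le> k" "k \<le> length C" using assms(1) by auto
  from this(2,1) show ?thesis
    using assms(2)
  proof (induction k arbitrary: \<tau> rule: inc_induct)
    case base
    then obtain \<tau>' where \<tau>': "\<tau>' \<in> gate_perms n E C (length C)"
      "Copy (length C) \<tau> \<rightarrow>\<^sup>*\<^bsub>X n E C\<^esub> Copy (length C) \<tau>'"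
      using next_gate[of "length C" \<tau>] by auto
    have "(Copy (length C) \<tau>', Snk) \<in> arcs (X n E C)"
      using \<tau>'(1) gates by (auto simp: X_def D_arcs_def)
    then show ?case using \<tau>'(2) adjI X.reachable_adj_trans by blast
  next
    case (step k)
    then obtain \<tau>' where \<tau>': "\<tau>' \<in> gate_perms n E C k"
      "Copy k \<tau> \<rightarrow>\<^sup>*\<^bsub>X n E C\<^esub> Copy k \<tau>'"
      using next_gate[of k \<tau>] by auto
    have "(Copy k \<tau>', Copy (Suc k) \<tau>') \<in> arcs (X n E C)"
      using \<tau>'(1) step by (auto simp: X_def D_arcs_def intro!: bexI[of _ k])
    moreover have "Copy (Suc k) \<tau>' \<rightarrow>\<^sup>*\<^bsub>X n E C\<^esub> Snk"
      using \<tau>'(1) gate_perms_sub by (intro step.IH) auto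
    ultimately show ?case
      using \<tau>'(2) adjI X.adj_reachable_trans X.reachable_trans by meson
  qed
qed

lemma reaches_Snk:
  assumes "v \<in> verts (X n E C)"
  shows "v \<rightarrow>\<^sup>*\<^bsub>X n E C\<^esub> Snk"
proof (cases v)
  case Src
  have id: "id \<in> Sn n" by (simp add: sym_group_def permutes_id)
  then have "(Src, Copy 1 id) \<in> arcs (X n E C)"
    by (auto simp: X_def D_arcs_def intro!: bexI[of _ 0])
  then show ?thesis
    using X.adj_reachable_trans[OF adjI Copy_reaches_Snk] id gates Src by simp
qed (use assms Copy_reaches_Snk in auto)

end

section \<open>The symmetry group and its actions\<close>

context routing
begin

lemma Sn_fix_comp: "a \<in> Sn_fix n C \<Longrightarrow> b \<in> Sn_fix n C \<Longrightarrow> a \<circ> b \<in> Sn_fix n C"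
  by (simp add: Sn_fix_def comp_mem_Sn image_comp[symmetric] del: image_comp o_apply)

lemma Sn_fix_inv:
  assumes "a \<in> Sn_fix n C"
  shows "inv' a \<in> Sn_fix n C"
proof -
  have inj: "inj a" using assms by (auto simp: Sn_fix_def sym_group_def permutes_inj)
  have "inv' a ` S = S" if "S \<in> fixing_pattern n C" for S
  proof -
    have "a ` S = S" using assms that by (simp add: Sn_fix_def)
    then show ?thesis using image_inv_f_f[OF inj, of S] by simp
  qed
  then show ?thesis using assms by (simp add: Sn_fix_def inv_mem_Sn)
qed

lemma Aut_coup_comp:
  assumes "a \<in> Aut_coup n E" "b \<in> Aut_coup n E"
  shows "a \<circ> b \<in> Aut_coup n E"
proof -
  have "b i \<in> {1..n}" if "i \<in> {1..n}" for i
    using assms(2) that permutes_in_image[of b "{1..n}" i] by (simp add: Aut_coup_def sym_group_def)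
  then show ?thesis using assms by (simp add: Aut_coup_def comp_mem_Sn)
qed

lemma Aut_coup_inv:
  assumes "b \<in> Aut_coup n E"
  shows "inv' b \<in> Aut_coup n E"
proof -
  have b: "b permutes {1..n}" using assms by (simp add: Aut_coup_def sym_group_def)
  have "{inv' b i, inv' b j} \<in> E \<longleftrightarrow> {i, j} \<in> E" if "i \<in> {1..n}" "j \<in> {1..n}" for i j
  proof -
    have "inv' b i \<in> {1..n}" "inv' b j \<in> {1..n}"
      using permutes_in_image[OF permutes_inv[OF b]] that by auto
    then have "{b (inv' b i), b (inv' b j)} \<in> E \<longleftrightarrow> {inv' b i, inv' b j} \<in> E"
      using assms by (simp add: Aut_coup_def)
    then show ?thesis by (simp add: permutes_inverses[OF b])
  qed
  then show ?thesis using assms by (simp add: Aut_coup_def inv_mem_Sn)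
qed

text \<open>
  The group inherits multiplication and unit from the full bijection group, so that the group laws
  only require closure of its carrier.
\<close>

lemma GX_eq: "GX n E C = (BijGroup (verts (X n E C)))\<lparr>carrier := carrier (GX n E C)\<rparr>"
  by (simp add: GX_def)

lemma GX_iff: "\<phi> \<in> carrier (GX n E C) \<longleftrightarrow> \<phi> \<in> Bij (verts (X n E C)) \<and>
    (\<forall>u\<in>verts (X n E C). \<forall>v\<in>verts (X n E C).
       (\<phi> u, \<phi> v) \<in> arcs (X n E C) \<longleftrightarrow> (u, v) \<in> arcs (X n E C)) \<and>
    \<phi> Src = Src \<and> \<phi> Snk = Snk \<and>
    (\<exists>a\<in>Sn_fix n C. \<exists>b\<in>Aut_coup n E. \<forall>k\<in>{1..length C}. \<forall>\<tau>\<in>Sn n.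
       \<phi> (Copy k \<tau>) = Copy k (a \<circ> \<tau> \<circ> inv' b))"
  by (simp add: GX_def)

lemma GX_maps:
  assumes "\<phi> \<in> carrier (GX n E C)" "v \<in> verts (X n E C)"
  shows "\<phi> v \<in> verts (X n E C)"
  using assms by (auto simp: GX_iff dest!: Bij_imp_funcset)

lemma GX_level:
  assumes "\<phi> \<in> carrier (GX n E C)" "v \<in> verts (X n E C)"
  shows "level (\<phi> v) = level v"
  using assms by (cases v) (auto simp: GX_iff)

lemma GX_arcs:
  assumes "\<phi> \<in> carrier (GX n E C)" "e \<in> arcs (X n E C)"
  shows "map_prod \<phi> \<phi> e \<in> arcs (X n E C)"
  using assms endpoints_mem[OF assms(2)] by (cases e) (simp add: GX_iff)

lemma GX_compose:
  assumes f: "f \<in> carrier (GX n E C)" and g: "g \<in> carrier (GX n E C)"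
  shows "compose (verts (X n E C)) f g \<in> carrier (GX n E C)"
proof -
  obtain a b where ab: "a \<in> Sn_fix n C" "b \<in> Aut_coup n E"
    "\<And>k \<tau>. k \<in> {1..length C} \<Longrightarrow> \<tau> \<in> Sn n \<Longrightarrow> f (Copy k \<tau>) = Copy k (a \<circ> \<tau> \<circ> inv' b)"
    using f by (auto simp: GX_iff)
  obtain a' b' where ab': "a' \<in> Sn_fix n C" "b' \<in> Aut_coup n E"
    "\<And>k \<tau>. k \<in> {1..length C} \<Longrightarrow> \<tau> \<in> Sn n \<Longrightarrow> g (Copy k \<tau>) = Copy k (a' \<circ> \<tau> \<circ> inv' b')"
    using g by (auto simp: GX_iff)
  have bij: "bij b" "bij b'"
    using ab(2) ab'(2) by (auto simp: Aut_coup_def sym_group_def permutes_bij)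
  have "compose (verts (X n E C)) f g (Copy k \<tau>) = Copy k ((a \<circ> a') \<circ> \<tau> \<circ> inv' (b \<circ> b'))"
    if "k \<in> {1..length C}" "\<tau> \<in> Sn n" for k \<tau>
  proof -
    have "a' \<circ> \<tau> \<circ> inv' b' \<in> Sn n"
      using that ab' by (auto simp: Sn_fix_def Aut_coup_def intro!: comp_mem_Sn inv_mem_Sn)
    then show ?thesis
      using that ab(3) ab'(3) by (simp add: compose_eq o_inv_distrib[OF bij] comp_assoc)
  qed
  moreover have "compose (verts (X n E C)) f g \<in> Bij (verts (X n E C))"
    using f g by (simp add: GX_iff compose_Bij)
  moreover have "compose (verts (X n E C)) f g Src = Src" "compose (verts (X n E C)) f g Snk = Snk"
    using f g by (simp_all add: compose_eq GX_iff)
  moreover have "(compose (verts (X n E C)) f g u, compose (verts (X n E C)) f g v) \<in> arcs (X n E C)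
      \<longleftrightarrow> (u, v) \<in> arcs (X n E C)"
    if "u \<in> verts (X n E C)" "v \<in> verts (X n E C)" for u v
    using f g that GX_maps[OF g] by (simp add: compose_eq GX_iff)
  ultimately show ?thesis
    using Sn_fix_comp[OF ab(1) ab'(1)] Aut_coup_comp[OF ab(2) ab'(2)] unfolding GX_iff by blast
qed

text \<open>
  The inverse of the symmetry given by \<open>(a, b)\<close> is the one given by
  \<open>(inv a, inv b)\<close>.
\<close>

lemma GX_inv:
  assumes f: "f \<in> carrier (GX n E C)"
  shows "restrict (inv_into (verts (X n E C)) f) (verts (X n E C)) \<in> carrier (GX n E C)"
proof -
  let ?V = "verts (X n E C)"
  let ?g = "restrict (inv_into ?V f) ?V"
  obtain a b where ab: "a \<in> Sn_fix n C" "b \<in> Aut_coup n E"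
    "\<And>k \<tau>. k \<in> {1..length C} \<Longrightarrow> \<tau> \<in> Sn n \<Longrightarrow> f (Copy k \<tau>) = Copy k (a \<circ> \<tau> \<circ> inv' b)"
    using f by (auto simp: GX_iff)
  have bij: "bij_betw f ?V ?V" using f by (simp add: GX_iff Bij_def)
  have g: "?g v \<in> ?V" "f (?g v) = v" if "v \<in> ?V" for v
    using bij that by (auto simp: bij_betw_def inv_into_into f_inv_into_f)
  have gI: "?g v = u" if "u \<in> ?V" "f u = v" for u v
    using bij that by (auto simp: bij_betw_def)
  have perm: "bij a" "bij b"
    using ab by (auto simp: Aut_coup_def Sn_fix_def sym_group_def permutes_bij)
  have "?g (Copy k \<tau>) = Copy k (inv' a \<circ> \<tau> \<circ> inv' (inv' b))"
    if k: "k \<in> {1..length C}" "\<tau> \<in> Sn n" for k \<tau>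
  proof (rule gI)
    have mem: "inv' a \<circ> \<tau> \<circ> b \<in> Sn n"
      using k ab by (auto simp: Sn_fix_def Aut_coup_def intro!: comp_mem_Sn inv_mem_Sn)
    then show "Copy k (inv' a \<circ> \<tau> \<circ> inv' (inv' b)) \<in> ?V"
      using k perm by (simp add: inv_inv_eq)
    have "a \<circ> (inv' a \<circ> \<tau> \<circ> b) \<circ> inv' b = \<tau>"
      using perm by (auto simp: fun_eq_iff bij_is_surj surj_f_inv_f)
    then show "f (Copy k (inv' a \<circ> \<tau> \<circ> inv' (inv' b))) = Copy k \<tau>"
      using ab(3)[OF k(1) mem] perm by (simp add: inv_inv_eq)
  qed
  moreover have "?g \<in> Bij ?V"
    using f by (simp add: GX_iff restrict_inv_into_Bij)
  moreover have "?g Src = Src" "?g Snk = Snk"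
    using f by (intro gI; simp add: GX_iff)+
  moreover have "(?g u, ?g v) \<in> arcs (X n E C) \<longleftrightarrow> (u, v) \<in> arcs (X n E C)"
    if "u \<in> ?V" "v \<in> ?V" for u v
    using f g[OF that(1)] g[OF that(2)] by (metis GX_iff)
  ultimately show ?thesis
    using Sn_fix_inv[OF ab(1)] Aut_coup_inv[OF ab(2)] unfolding GX_iff by blast
qed

lemma GX_subgroup: "subgroup (carrier (GX n E C)) (BijGroup (verts (X n E C)))"
proof (rule group.subgroupI[OF group_BijGroup])
  show "carrier (GX n E C) \<subseteq> carrier (BijGroup (verts (X n E C)))"
    by (auto simp: GX_iff BijGroup_def)
  have "(\<lambda>x\<in>verts (X n E C). x) \<in> carrier (GX n E C)"
  proof -
    have "id \<in> Sn_fix n C" "id \<in> Aut_coup n E"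
      by (auto simp: Sn_fix_def Aut_coup_def sym_group_def permutes_id)
    then show ?thesis
      unfolding GX_iff
      by (auto simp: id_Bij intro!: bexI[of _ id])
  qed
  then show "carrier (GX n E C) \<noteq> {}" by blast
next
  fix f assume "f \<in> carrier (GX n E C)"
  then show "inv\<^bsub>BijGroup (verts (X n E C))\<^esub> f \<in> carrier (GX n E C)"
    using GX_inv by (simp add: inv_BijGroup GX_iff)
next
  fix f g assume "f \<in> carrier (GX n E C)" "g \<in> carrier (GX n E C)"
  then show "f \<otimes>\<^bsub>BijGroup (verts (X n E C))\<^esub> g \<in> carrier (GX n E C)"
    using GX_compose by (simp add: BijGroup_def GX_iff)
qed

lemma group_GX: "group (GX n E C)"
  using subgroup.subgroup_is_group[OF GX_subgroup group_BijGroup] GX_eq by simp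

lemma mult_GX:
  assumes "f \<in> carrier (GX n E C)" "g \<in> carrier (GX n E C)"
  shows "f \<otimes>\<^bsub>GX n E C\<^esub> g = compose (verts (X n E C)) f g"
  using assms by (subst GX_eq) (simp add: BijGroup_def GX_iff)

lemma action_verts: "group_action (GX n E C) (verts (X n E C)) (\<lambda>\<phi>. \<phi>)"
proof -
  have "(\<lambda>\<phi>. \<phi>) \<in> hom (GX n E C) (BijGroup (verts (X n E C)))"
  proof (rule homI)
    fix f g assume "f \<in> carrier (GX n E C)" "g \<in> carrier (GX n E C)"
    then show "f \<otimes>\<^bsub>GX n E C\<^esub> g = f \<otimes>\<^bsub>BijGroup (verts (X n E C))\<^esub> g"
      by (simp add: mult_GX) (simp add: BijGroup_def GX_iff)
  qed (simp add: GX_iff BijGroup_def)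
  then show ?thesis
    by (intro group_action.intro group_hom.intro group_hom_axioms.intro group_GX group_BijGroup)
qed

lemma arc_action_apply:
  "e \<in> arcs (X n E C) \<Longrightarrow> arc_action n E C \<phi> e = (\<phi> (fst e), \<phi> (snd e))"
  by (cases e) (simp add: arc_action_def)

lemma arc_action_mem:
  "\<phi> \<in> carrier (GX n E C) \<Longrightarrow> e \<in> arcs (X n E C) \<Longrightarrow> arc_action n E C \<phi> e \<in> arcs (X n E C)"
  using GX_arcs[of \<phi> e] by (simp add: arc_action_apply map_prod_def split_beta)

lemma arc_action_Bij:
  assumes \<phi>: "\<phi> \<in> carrier (GX n E C)"
  shows "arc_action n E C \<phi> \<in> Bij (arcs (X n E C))"
proof -
  have "inj_on \<phi> (verts (X n E C))" using \<phi> by (auto simp: GX_iff Bij_def bij_betw_def)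
  then have "inj_on (arc_action n E C \<phi>) (arcs (X n E C))"
    using endpoints_mem by (auto simp: inj_on_def arc_action_apply prod_eq_iff)
  moreover have "arc_action n E C \<phi> ` arcs (X n E C) \<subseteq> arcs (X n E C)"
    using arc_action_mem[OF \<phi>] by blast
  ultimately have "bij_betw (arc_action n E C \<phi>) (arcs (X n E C)) (arcs (X n E C))"
    using endo_inj_surj[OF X.finite_arcs] by (simp add: bij_betw_def)
  then show ?thesis by (simp add: Bij_def arc_action_def)
qed

lemma action_arcs: "group_action (GX n E C) (arcs (X n E C)) (arc_action n E C)"
proof -
  have "arc_action n E C \<in> hom (GX n E C) (BijGroup (arcs (X n E C)))"
  proof (rule homI)
    fix f g assume fg: "f \<in> carrier (GX n E C)" "g \<in> carrier (GX n E C)"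
    have "arc_action n E C (compose (verts (X n E C)) f g) =
        compose (arcs (X n E C)) (arc_action n E C f) (arc_action n E C g)"
    proof (rule extensionalityI)
      fix e assume e: "e \<in> arcs (X n E C)"
      show "arc_action n E C (compose (verts (X n E C)) f g) e =
          compose (arcs (X n E C)) (arc_action n E C f) (arc_action n E C g) e"
        using e endpoints_mem[OF e] arc_action_mem[OF fg(2) e]
        by (simp add: compose_eq arc_action_apply)
    qed (auto simp: arc_action_def compose_def)
    then show "arc_action n E C (f \<otimes>\<^bsub>GX n E C\<^esub> g) =
        arc_action n E C f \<otimes>\<^bsub>BijGroup (arcs (X n E C))\<^esub> arc_action n E C g"
      using fg by (simp add: mult_GX BijGroup_def arc_action_Bij)
  qed (simp add: arc_action_Bij BijGroup_def)
  then show ?thesis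
    by (intro group_action.intro group_hom.intro group_hom_axioms.intro group_GX group_BijGroup)
qed

end

sublocale routing \<subseteq> tails: equivariant_map "GX n E C" "arcs (X n E C)" "arc_action n E C" "verts (X n E C)" "\<lambda>\<phi>. \<phi>" fst
  by (intro equivariant_map.intro action_arcs action_verts equivariant_map_axioms.intro)
     (simp_all add: endpoints_mem arc_action_apply)

sublocale routing \<subseteq> heads: equivariant_map "GX n E C" "arcs (X n E C)" "arc_action n E C" "verts (X n E C)" "\<lambda>\<phi>. \<phi>" snd
  by (intro equivariant_map.intro action_arcs action_verts equivariant_map_axioms.intro)
     (simp_all add: endpoints_mem arc_action_apply)

section \<open>The quotient graph\<close>

context routing
begin

abbreviation Q where "Q \<equiv> quotient_graph n E C"

abbreviation vorbit :: "vertex \<Rightarrow> vertex set" where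
  "vorbit \<equiv> orbit (GX n E C) (\<lambda>\<phi>. \<phi>)"

lemma A_arcs_invariant:
  "k \<in> {1..length C} \<Longrightarrow> \<phi> \<in> carrier (GX n E C) \<Longrightarrow> e \<in> A_arcs n E k \<Longrightarrow>
     arc_action n E C \<phi> e \<in> A_arcs n E k"
  by (simp add: A_arcs_iff arc_action_mem) (simp add: arc_action_apply GX_level endpoints_mem)

lemma D_arcs_invariant:
  "k \<le> length C \<Longrightarrow> \<phi> \<in> carrier (GX n E C) \<Longrightarrow> e \<in> D_arcs n E C k \<Longrightarrow>
     arc_action n E C \<phi> e \<in> D_arcs n E C k"
  by (simp add: D_arcs_iff arc_action_mem) (simp add: arc_action_apply GX_level endpoints_mem)

lemma A_arcs_sub: "k \<in> {1..length C} \<Longrightarrow> A_arcs n E k \<subseteq> arcs (X n E C)"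
  and D_arcs_sub: "k \<le> length C \<Longrightarrow> D_arcs n E C k \<subseteq> arcs (X n E C)"
  by (auto simp: X_def)

lemma A_arcs_tails: "k \<in> {1..length C} \<Longrightarrow> invariant_arcs (GX n E C) (arcs (X n E C)) (arc_action n E C)
    (verts (X n E C)) (\<lambda>\<phi>. \<phi>) fst (A_arcs n E k)"
  by (intro invariant_arcs.intro tails.equivariant_map_axioms invariant_arcs_axioms.intro
      A_arcs_sub A_arcs_invariant)

lemma A_arcs_heads: "k \<in> {1..length C} \<Longrightarrow> invariant_arcs (GX n E C) (arcs (X n E C)) (arc_action n E C)
    (verts (X n E C)) (\<lambda>\<phi>. \<phi>) snd (A_arcs n E k)"
  by (intro invariant_arcs.intro heads.equivariant_map_axioms invariant_arcs_axioms.intro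
      A_arcs_sub A_arcs_invariant)

lemma D_arcs_tails: "k \<le> length C \<Longrightarrow> invariant_arcs (GX n E C) (arcs (X n E C)) (arc_action n E C)
    (verts (X n E C)) (\<lambda>\<phi>. \<phi>) fst (D_arcs n E C k)"
  by (intro invariant_arcs.intro tails.equivariant_map_axioms invariant_arcs_axioms.intro
      D_arcs_sub D_arcs_invariant)

lemma D_arcs_heads: "k \<le> length C \<Longrightarrow> invariant_arcs (GX n E C) (arcs (X n E C)) (arc_action n E C)
    (verts (X n E C)) (\<lambda>\<phi>. \<phi>) snd (D_arcs n E C k)"
  by (intro invariant_arcs.intro heads.equivariant_map_axioms invariant_arcs_axioms.intro
      D_arcs_sub D_arcs_invariant)

lemma arcs_Q: "arcs Q = orbits (GX n E C) (arcs (X n E C)) (arc_action n E C)"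
  and verts_Q: "verts Q = orbits (GX n E C) (verts (X n E C)) (\<lambda>\<phi>. \<phi>)"
  by (simp_all add: quotient_graph_def)

lemma tail_Q: "W \<in> arcs Q \<Longrightarrow> tail Q W = fst ` W"
  and head_Q: "W \<in> arcs Q \<Longrightarrow> head Q W = snd ` W"
  using tails.the_orbit_of_image heads.the_orbit_of_image by (simp_all add: quotient_graph_def)

lemma A_orbitals_sub: "k \<in> {1..length C} \<Longrightarrow> A_orbitals n E C k \<subseteq> arcs Q"
  and D_orbitals_sub: "k \<le> length C \<Longrightarrow> D_orbitals n E C k \<subseteq> arcs Q"
  using invariant_arcs.orbits_sub[OF A_arcs_tails] invariant_arcs.orbits_sub[OF D_arcs_tails]
  by (simp_all add: A_orbitals_def D_orbitals_def arcs_Q)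

text \<open>
  Since the families are invariant, a single arc decides to which family an orbital belongs.  So
  the separation of the arc families by levels passes to the orbitals.
\<close>

lemma mem_A_orbitals_iff:
  assumes "W \<in> arcs Q" "e \<in> W" "k \<in> {1..length C}"
  shows "W \<in> A_orbitals n E C k \<longleftrightarrow> e \<in> A_arcs n E k"
proof
  assume "e \<in> A_arcs n E k"
  then show "W \<in> A_orbitals n E C k"
    using tails.A.orbits_memD(2) assms unfolding arcs_Q A_orbitals_def orbits_def[of _ "A_arcs n E k"] by blast
next
  assume "W \<in> A_orbitals n E C k"
  then show "e \<in> A_arcs n E k"
    using invariant_arcs.mem_orbital_iff[OF A_arcs_tails] assms unfolding A_orbitals_def by blast
qed

lemma mem_D_orbitals_iff:
  assumes "W \<in> arcs Q" "e \<in> W" "k \<le> length C"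
  shows "W \<in> D_orbitals n E C k \<longleftrightarrow> e \<in> D_arcs n E C k"
proof
  assume "e \<in> D_arcs n E C k"
  then show "W \<in> D_orbitals n E C k"
    using tails.A.orbits_memD(2) assms unfolding arcs_Q D_orbitals_def orbits_def[of _ "D_arcs n E C k"] by blast
next
  assume "W \<in> D_orbitals n E C k"
  then show "e \<in> D_arcs n E C k"
    using invariant_arcs.mem_orbital_iff[OF D_arcs_tails] assms unfolding D_orbitals_def by blast
qed

lemma orbital_nonempty: "W \<in> arcs Q \<Longrightarrow> \<exists>e. e \<in> W"
  using tails.A.orbits_nonempty unfolding arcs_Q by blast

lemma orbital_subset_arcs: "W \<in> arcs Q \<Longrightarrow> e \<in> W \<Longrightarrow> e \<in> arcs (X n E C)"
  using tails.A.orbits_memD(1) unfolding arcs_Q by blast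

lemma A_D_disjoint:
  assumes "W \<in> A_orbitals n E C k" "k \<in> {1..length C}" "l \<le> length C"
  shows "W \<notin> D_orbitals n E C l"
proof
  assume W: "W \<in> D_orbitals n E C l"
  have Q: "W \<in> arcs Q" using assms A_orbitals_sub by blast
  then obtain e where e: "e \<in> W" using orbital_nonempty by blast
  show False
    using mem_A_orbitals_iff[OF Q e assms(2)] mem_D_orbitals_iff[OF Q e assms(3)] assms W
    by (auto simp: A_arcs_iff D_arcs_iff)
qed

lemma A_A_disjoint:
  assumes "W \<in> A_orbitals n E C k" "k \<in> {1..length C}" "W \<in> A_orbitals n E C l" "l \<in> {1..length C}"
  shows "k = l"
proof -
  have Q: "W \<in> arcs Q" using assms A_orbitals_sub by blast
  then obtain e where e: "e \<in> W" using orbital_nonempty by blast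
  show ?thesis
    using mem_A_orbitals_iff[OF Q e] assms by (auto simp: A_arcs_iff)
qed

lemma D_D_disjoint:
  assumes "W \<in> D_orbitals n E C k" "k \<le> length C" "W \<in> D_orbitals n E C l" "l \<le> length C"
  shows "k = l"
proof -
  have Q: "W \<in> arcs Q" using assms D_orbitals_sub by blast
  then obtain e where e: "e \<in> W" using orbital_nonempty by blast
  show ?thesis
    using mem_D_orbitals_iff[OF Q e] assms by (auto simp: D_arcs_iff)
qed

lemma arcs_Q_cases:
  assumes "W \<in> arcs Q"
  obtains (A) k where "k \<in> {1..length C}" "W \<in> A_orbitals n E C k"
    | (D) k where "k \<le> length C" "W \<in> D_orbitals n E C k"
proof -
  obtain e where e: "e \<in> W" using orbital_nonempty[OF assms] by blast
  from orbital_subset_arcs[OF assms this] show thesis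
    by (cases rule: arcs_X_cases) (use mem_A_orbitals_iff[OF assms e] mem_D_orbitals_iff[OF assms e] that in auto)
qed

lemma out_deg_pos: "W \<in> arcs Q \<Longrightarrow> 0 < out_deg W"
  and in_deg_pos: "W \<in> arcs Q \<Longrightarrow> 0 < in_deg W"
  using tails.fibre_size_pos heads.fibre_size_pos
  by (simp_all add: arcs_Q out_deg_eq_fibre_size in_deg_eq_fibre_size)

text \<open>
  The arcs in \<open>D_arcs n E C k\<close> form a matching for \<open>0 < k < length C\<close>, and at the
  two ends they still have distinct heads (\<open>k = 0\<close>) or distinct tails
  (\<open>k = length C\<close>).  This is why the conservation constraints of (RSPP) have no degree
  coefficients in front of \<open>\<theta>\<close>.
\<close>

lemma D_out_deg:
  assumes "W \<in> D_orbitals n E C k" "k \<in> {1..length C}"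
  shows "out_deg W = 1"
proof -
  have Q: "W \<in> arcs Q" using assms D_orbitals_sub[of k] by auto
  have "inj_on fst (D_arcs n E C k)" using assms(2) by (auto simp: D_arcs_def inj_on_def)
  moreover have "W \<subseteq> D_arcs n E C k" using mem_D_orbitals_iff[OF Q] assms by auto
  ultimately show ?thesis
    using tails.fibre_size_eq_1 Q inj_on_subset by (simp add: arcs_Q out_deg_eq_fibre_size) blast
qed

lemma D_in_deg:
  assumes "W \<in> D_orbitals n E C k" "k < length C"
  shows "in_deg W = 1"
proof -
  have Q: "W \<in> arcs Q" using assms D_orbitals_sub[of k] by auto
  have "inj_on snd (D_arcs n E C k)" using assms(2) by (auto simp: D_arcs_def inj_on_def)
  moreover have "W \<subseteq> D_arcs n E C k" using mem_D_orbitals_iff[OF Q] assms by auto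
  ultimately show ?thesis
    using heads.fibre_size_eq_1 Q inj_on_subset by (simp add: arcs_Q in_deg_eq_fibre_size) blast
qed

lemma vorbit_Src: "vorbit Src = {Src}" and vorbit_Snk: "vorbit Snk = {Snk}"
  using tails.B.orbit_refl[of Src] tails.B.orbit_refl[of Snk] by (auto simp: orbit_def GX_iff)

lemma V_orbits_iff:
  assumes "k \<in> {1..length C}" "v \<in> U"
  shows "U \<in> V_orbits n E C k \<longleftrightarrow> v \<in> layer n k \<and> U = vorbit v"
proof
  assume "U \<in> V_orbits n E C k"
  then obtain w where w: "w \<in> layer n k" "U = vorbit w" by (auto simp: V_orbits_def orbits_def)
  then have wV: "w \<in> verts (X n E C)" using assms(1) layer_iff by blast
  obtain \<phi> where "\<phi> \<in> carrier (GX n E C)" "v = \<phi> w" using assms(2) w(2) by (auto simp: orbit_def)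
  then have "v \<in> layer n k"
    using w(1) wV GX_maps GX_level assms(1) by (simp add: layer_iff)
  then show "v \<in> layer n k \<and> U = vorbit v"
    using tails.B.orbit_eq[OF wV] assms(2) w(2) by blast
qed (auto simp: V_orbits_def orbits_def)

lemma vorbit_in_V_orbits: "v \<in> layer n k \<Longrightarrow> vorbit v \<in> V_orbits n E C k"
  by (auto simp: V_orbits_def orbits_def)

lemma V_orbits_sub: "k \<in> {1..length C} \<Longrightarrow> V_orbits n E C k \<subseteq> verts Q"
  by (auto simp: verts_Q V_orbits_def orbits_def layer_iff)

lemma V_orbits_nonempty:
  assumes "k \<in> {1..length C}" "U \<in> V_orbits n E C k"
  shows "\<exists>v. v \<in> U"
  using tails.B.orbits_nonempty V_orbits_sub assms unfolding verts_Q by blast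

text \<open>
  The constraints of (GNFP) range over orbits of the quotient graph and those of (RSPP) over orbits
  of layers.  These are the same orbits.
\<close>

lemma inner_orbits_iff:
  "U \<in> verts Q - {{Src}, {Snk}} \<longleftrightarrow> (\<exists>k\<in>{1..length C}. U \<in> V_orbits n E C k)"
proof
  assume U: "U \<in> verts Q - {{Src}, {Snk}}"
  then obtain v where v: "v \<in> verts (X n E C)" "U = vorbit v" by (auto simp: verts_Q orbits_def)
  then have "v \<noteq> Src" "v \<noteq> Snk" using U vorbit_Src vorbit_Snk by auto
  then have "level v \<in> {1..length C}" using v by (cases v) auto
  then show "\<exists>k\<in>{1..length C}. U \<in> V_orbits n E C k"
    using v vorbit_in_V_orbits layer_iff by blast
next
  assume "\<exists>k\<in>{1..length C}. U \<in> V_orbits n E C k"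
  then obtain k where k: "k \<in> {1..length C}" "U \<in> V_orbits n E C k" by blast
  then obtain v where v: "v \<in> U" using V_orbits_nonempty by blast
  then have "level v = k" using V_orbits_iff[OF k(1) v] layer_iff[OF k(1)] k(2) by blast
  then have "v \<noteq> Src" "v \<noteq> Snk" using k by auto
  then show "U \<in> verts Q - {{Src}, {Snk}}" using V_orbits_sub[OF k(1)] k(2) v by auto
qed

lemma Src_Q: "{Src} \<in> verts Q" and Snk_Q: "{Snk} \<in> verts Q"
  using vorbit_Src vorbit_Snk Src_verts Snk_verts unfolding verts_Q orbits_def by blast+

lemma fin_digraph_Q: "fin_digraph Q"
proof
  show "finite (verts Q)" "finite (arcs Q)"
    using finite_imageI[OF X.finite_verts] finite_imageI[OF X.finite_arcs]
    by (simp_all only: verts_Q arcs_Q orbits_def Setcompr_eq_image)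
  fix W assume W: "W \<in> arcs Q"
  show "tail Q W \<in> verts Q" "head Q W \<in> verts Q"
    using tails.image_orbital_mem heads.image_orbital_mem W
    by (simp_all add: tail_Q[OF W] head_Q[OF W]) (simp_all add: arcs_Q verts_Q)
qed

lemma mem_out_arcs_Q:
  assumes "v \<in> verts (X n E C)"
  shows "W \<in> out_arcs Q (vorbit v) \<longleftrightarrow> W \<in> arcs Q \<and> (\<exists>e\<in>W. fst e = v)"
proof -
  have "fst ` W = vorbit v \<longleftrightarrow> (\<exists>e\<in>W. fst e = v)" if "W \<in> arcs Q"
    using tails.image_orbital_eq_iff[of W v] assms that unfolding arcs_Q by (metis imageE imageI)
  then show ?thesis by (cases "W \<in> arcs Q") (simp_all only: in_in_arcs_conv in_out_arcs_conv tail_Q simp_thms)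
qed

lemma mem_in_arcs_Q:
  assumes "v \<in> verts (X n E C)"
  shows "W \<in> in_arcs Q (vorbit v) \<longleftrightarrow> W \<in> arcs Q \<and> (\<exists>e\<in>W. snd e = v)"
proof -
  have "snd ` W = vorbit v \<longleftrightarrow> (\<exists>e\<in>W. snd e = v)" if "W \<in> arcs Q"
    using heads.image_orbital_eq_iff[of W v] assms that unfolding arcs_Q by (metis imageE imageI)
  then show ?thesis by (cases "W \<in> arcs Q") (simp_all only: in_in_arcs_conv in_out_arcs_conv head_Q simp_thms)
qed

text \<open>
  Levels are constant on orbits, so at an orbit of level \<open>k\<close> only two families of orbitals
  start and only two families end.  This splits the flow sums of (GNFP) into the two sums
  of (RSPP).
\<close>

lemma out_arcs_Q_level:
  assumes v: "v \<in> verts (X n E C)" and W: "W \<in> out_arcs Q (vorbit v)"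
  shows "(\<forall>k\<in>{1..length C}. W \<in> A_orbitals n E C k \<longrightarrow> k = level v) \<and>
         (\<forall>k\<le>length C. W \<in> D_orbitals n E C k \<longrightarrow> k = level v)"
proof -
  obtain e where e: "W \<in> arcs Q" "e \<in> W" "fst e = v" using mem_out_arcs_Q[OF v] W by blast
  show ?thesis
    using mem_A_orbitals_iff[OF e(1,2)] mem_D_orbitals_iff[OF e(1,2)] e(3)
    by (auto simp: A_arcs_iff D_arcs_iff)
qed

lemma in_arcs_Q_level:
  assumes v: "v \<in> verts (X n E C)" and W: "W \<in> in_arcs Q (vorbit v)"
  shows "(\<forall>k\<in>{1..length C}. W \<in> A_orbitals n E C k \<longrightarrow> k = level v) \<and>
         (\<forall>k\<le>length C. W \<in> D_orbitals n E C k \<longrightarrow> Suc k = level v)"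
proof -
  obtain e where e: "W \<in> arcs Q" "e \<in> W" "snd e = v" using mem_in_arcs_Q[OF v] W by blast
  show ?thesis
    using mem_A_orbitals_iff[OF e(1,2)] mem_D_orbitals_iff[OF e(1,2)] e(3)
    by (auto simp: A_arcs_iff D_arcs_iff)
qed

lemma out_arcs_Q_Src: "out_arcs Q {Src} = D_orbitals n E C 0"
proof (intro equalityI subsetI)
  fix W assume W: "W \<in> out_arcs Q {Src}"
  then have "W \<in> arcs Q" by simp
  then show "W \<in> D_orbitals n E C 0"
    by (cases rule: arcs_Q_cases) (use out_arcs_Q_level[of Src W] W vorbit_Src in auto)
next
  fix W assume W: "W \<in> D_orbitals n E C 0"
  then have Q: "W \<in> arcs Q" using D_orbitals_sub by blast
  then obtain e where e: "e \<in> W" using orbital_nonempty by blast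
  then have "fst e = Src"
    using mem_D_orbitals_iff[OF Q e, of 0] W by (auto simp: D_arcs_def)
  then show "W \<in> out_arcs Q {Src}"
    using mem_out_arcs_Q[of Src W] Q e vorbit_Src by auto
qed

lemma in_arcs_Q_Snk: "in_arcs Q {Snk} = D_orbitals n E C (length C)"
proof (intro equalityI subsetI)
  fix W assume W: "W \<in> in_arcs Q {Snk}"
  then have "W \<in> arcs Q" by simp
  then show "W \<in> D_orbitals n E C (length C)"
    by (cases rule: arcs_Q_cases) (use in_arcs_Q_level[of Snk W] W vorbit_Snk in auto)
next
  fix W assume W: "W \<in> D_orbitals n E C (length C)"
  then have Q: "W \<in> arcs Q" using D_orbitals_sub by blast
  then obtain e where e: "e \<in> W" using orbital_nonempty by blast
  then have "snd e = Snk"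
    using mem_D_orbitals_iff[OF Q e, of "length C"] W gates by (auto simp: D_arcs_def split: if_splits)
  then show "W \<in> in_arcs Q {Snk}"
    using mem_in_arcs_Q[of Snk W] Q e vorbit_Snk by auto
qed

lemma sum_out_arcs_Q:
  fixes f :: "arc set \<Rightarrow> real"
  assumes k: "k \<in> {1..length C}" and U: "U \<in> V_orbits n E C k"
  shows "sum f (out_arcs Q U) =
    sum f (out_arcs Q U \<inter> D_orbitals n E C k) + sum f (out_arcs Q U \<inter> A_orbitals n E C k)"
proof -
  obtain v where v: "v \<in> U" using V_orbits_nonempty[OF k U] by blast
  have vU: "v \<in> verts (X n E C)" "level v = k" "U = vorbit v"
    using V_orbits_iff[OF k v] layer_iff[OF k] U by auto
  have "W \<in> D_orbitals n E C k \<or> W \<in> A_orbitals n E C k" if W: "W \<in> out_arcs Q U" for W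
  proof -
    have "W \<in> arcs Q" using W by simp
    then show ?thesis
      by (cases rule: arcs_Q_cases) (use out_arcs_Q_level[OF vU(1), of W] W vU in auto)
  qed
  then have "out_arcs Q U = (out_arcs Q U \<inter> D_orbitals n E C k) \<union> (out_arcs Q U \<inter> A_orbitals n E C k)"
    by blast
  moreover have "(out_arcs Q U \<inter> D_orbitals n E C k) \<inter> (out_arcs Q U \<inter> A_orbitals n E C k) = {}"
    using A_D_disjoint[of _ k k] k by auto
  moreover have "finite (out_arcs Q U)" using fin_digraph.finite_out_arcs[OF fin_digraph_Q] .
  ultimately show ?thesis by (metis finite_Int sum.union_disjoint)
qed

lemma sum_in_arcs_Q:
  fixes f :: "arc set \<Rightarrow> real"
  assumes k: "k \<in> {1..length C}" and U: "U \<in> V_orbits n E C k"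
  shows "sum f (in_arcs Q U) =
    sum f (in_arcs Q U \<inter> D_orbitals n E C (k - 1)) + sum f (in_arcs Q U \<inter> A_orbitals n E C k)"
proof -
  obtain v where v: "v \<in> U" using V_orbits_nonempty[OF k U] by blast
  have vU: "v \<in> verts (X n E C)" "level v = k" "U = vorbit v"
    using V_orbits_iff[OF k v] layer_iff[OF k] U by auto
  have "W \<in> D_orbitals n E C (k - 1) \<or> W \<in> A_orbitals n E C k" if W: "W \<in> in_arcs Q U" for W
  proof -
    have "W \<in> arcs Q" using W by simp
    then show ?thesis
    proof (cases rule: arcs_Q_cases)
      case (D j)
      then have "Suc j = k" using in_arcs_Q_level[OF vU(1), of W] W vU by blast
      then show ?thesis using D by auto
    qed (use in_arcs_Q_level[OF vU(1), of W] W vU in auto)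
  qed
  then have "in_arcs Q U = (in_arcs Q U \<inter> D_orbitals n E C (k - 1)) \<union> (in_arcs Q U \<inter> A_orbitals n E C k)"
    by blast
  moreover have "(in_arcs Q U \<inter> D_orbitals n E C (k - 1)) \<inter> (in_arcs Q U \<inter> A_orbitals n E C k) = {}"
    using A_D_disjoint[of _ k "k - 1"] k by auto
  moreover have "finite (in_arcs Q U)" using fin_digraph.finite_in_arcs[OF fin_digraph_Q] .
  ultimately show ?thesis by (metis finite_Int sum.union_disjoint)
qed

end

section \<open>Programs with the same attainable costs\<close>

text \<open>
  Feasible solutions need not correspond one to one: the same attainable costs are enough for
  optimality to carry over.
\<close>

lemma is_arg_min_transfer:
  fixes f :: "'a \<Rightarrow> real" and g :: "'b \<Rightarrow> real"
  assumes "f x = g y" "P x \<longleftrightarrow> R y"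
    and "\<And>z. P z \<Longrightarrow> \<exists>w. R w \<and> g w = f z" "\<And>w. R w \<Longrightarrow> \<exists>z. P z \<and> f z = g w"
  shows "is_arg_min f P x \<longleftrightarrow> is_arg_min g R y"
  using assms unfolding is_arg_min_def by metis

lemma opt_value_transfer:
  fixes f :: "'a \<Rightarrow> real" and g :: "'b \<Rightarrow> real"
  assumes fg: "\<And>z. P z \<Longrightarrow> \<exists>w. R w \<and> g w = f z" and gf: "\<And>w. R w \<Longrightarrow> \<exists>z. P z \<and> f z = g w"
    and opt: "opt_value f P v"
  shows "opt_value g R v"
proof -
  obtain x where x: "is_arg_min f P x" "f x = v" using opt by (auto simp: opt_value_def)
  then obtain y where "R y" "g y = f x" using fg by (auto simp: is_arg_min_def)
  then have "is_arg_min g R y"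
    using is_arg_min_transfer[of f x g y P R] x fg gf by (auto simp: is_arg_min_def)
  then show ?thesis using \<open>g y = f x\<close> x(2) by (auto simp: opt_value_def)
qed

section \<open>(SPP) and (RSPP)\<close>

context routing
begin

lemma layer_verts: "k \<in> {1..length C} \<Longrightarrow> v \<in> layer n k \<Longrightarrow> v \<in> verts (X n E C)"
  using layer_iff by blast

lemma out_arcs_X_Int: "T \<subseteq> arcs (X n E C) \<Longrightarrow> out_arcs (X n E C) v \<inter> T = {e \<in> T. fst e = v}"
  and in_arcs_X_Int: "T \<subseteq> arcs (X n E C) \<Longrightarrow> in_arcs (X n E C) v \<inter> T = {e \<in> T. snd e = v}"
  by auto

lemma out_arcs_Q_Int:
  assumes "T \<subseteq> arcs Q"
  shows "out_arcs Q U \<inter> T = {W \<in> T. fst ` W = U}"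
proof (rule Set.set_eqI)
  fix W
  show "W \<in> out_arcs Q U \<inter> T \<longleftrightarrow> W \<in> {W \<in> T. fst ` W = U}"
    using tail_Q[of W] subsetD[OF assms, of W] by (cases "W \<in> T") simp_all
qed

lemma in_arcs_Q_Int:
  assumes "T \<subseteq> arcs Q"
  shows "in_arcs Q U \<inter> T = {W \<in> T. snd ` W = U}"
proof (rule Set.set_eqI)
  fix W
  show "W \<in> in_arcs Q U \<inter> T \<longleftrightarrow> W \<in> {W \<in> T. snd ` W = U}"
    using head_Q[of W] subsetD[OF assms, of W] by (cases "W \<in> T") simp_all
qed

text \<open>
  The substitution in the form that \<open>sum_fibre\<close> expects.
\<close>

lemma orbital_subst_A:
  "orbital_subst n E C (lam, \<theta>) (x, y) \<Longrightarrow> k \<in> {1..length C} \<Longrightarrow>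
     W \<in> orbits (GX n E C) (A_arcs n E k) (arc_action n E C) \<Longrightarrow> e \<in> W \<Longrightarrow> x e = lam W"
  and orbital_subst_D:
  "orbital_subst n E C (lam, \<theta>) (x, y) \<Longrightarrow> k \<le> length C \<Longrightarrow>
     W \<in> orbits (GX n E C) (D_arcs n E C k) (arc_action n E C) \<Longrightarrow> e \<in> W \<Longrightarrow> y e = \<theta> W"
  by (auto simp: orbital_subst_def A_orbitals_def D_orbitals_def)

lemma spp_in_eq_rspp_in:
  assumes k: "k \<in> {1..length C}" and v: "v \<in> layer n k"
    and os: "orbital_subst n E C (lam, \<theta>) (x, y)"
  shows "spp_in n E C x y k v = rspp_in n E C lam \<theta> k (vorbit v)"
proof -
  have V: "v \<in> verts (X n E C)" using layer_verts[OF k v] .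
  have k': "k - 1 \<le> length C" "k - 1 < length C" using k by auto
  have "(\<Sum>e\<in>{e \<in> A_arcs n E k. snd e = v}. x e) =
      (\<Sum>W\<in>{W \<in> A_orbitals n E C k. snd ` W = vorbit v}. real (in_deg W) * lam W)"
    unfolding A_orbitals_def in_deg_eq_fibre_size
    by (rule invariant_arcs.sum_fibre[OF A_arcs_heads[OF k] V orbital_subst_A[OF os k]])
  moreover have "(\<Sum>e\<in>{e \<in> D_arcs n E C (k - 1). snd e = v}. y e) =
      (\<Sum>W\<in>{W \<in> D_orbitals n E C (k - 1). snd ` W = vorbit v}. real (in_deg W) * \<theta> W)"
    unfolding D_orbitals_def in_deg_eq_fibre_size
    by (rule invariant_arcs.sum_fibre[OF D_arcs_heads[OF k'(1)] V orbital_subst_D[OF os k'(1)]])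
  ultimately show ?thesis
    using D_in_deg[OF _ k'(2)]
    unfolding spp_in_def rspp_in_def in_arcs_X_Int[OF A_arcs_sub[OF k]] in_arcs_X_Int[OF D_arcs_sub[OF k'(1)]]
      in_arcs_Q_Int[OF A_orbitals_sub[OF k]] in_arcs_Q_Int[OF D_orbitals_sub[OF k'(1)]]
    by simp
qed

lemma spp_out_eq_rspp_out:
  assumes k: "k \<in> {1..length C}" and v: "v \<in> layer n k"
    and os: "orbital_subst n E C (lam, \<theta>) (x, y)"
  shows "spp_out n E C x y k v = rspp_out n E C lam \<theta> k (vorbit v)"
proof -
  have V: "v \<in> verts (X n E C)" using layer_verts[OF k v] .
  have k': "k \<le> length C" using k by auto
  have "(\<Sum>e\<in>{e \<in> A_arcs n E k. fst e = v}. x e) =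
      (\<Sum>W\<in>{W \<in> A_orbitals n E C k. fst ` W = vorbit v}. real (out_deg W) * lam W)"
    unfolding A_orbitals_def out_deg_eq_fibre_size
    by (rule invariant_arcs.sum_fibre[OF A_arcs_tails[OF k] V orbital_subst_A[OF os k]])
  moreover have "(\<Sum>e\<in>{e \<in> D_arcs n E C k. fst e = v}. y e) =
      (\<Sum>W\<in>{W \<in> D_orbitals n E C k. fst ` W = vorbit v}. real (out_deg W) * \<theta> W)"
    unfolding D_orbitals_def out_deg_eq_fibre_size
    by (rule invariant_arcs.sum_fibre[OF D_arcs_tails[OF k'] V orbital_subst_D[OF os k']])
  ultimately show ?thesis
    using D_out_deg[OF _ k]
    unfolding spp_out_def rspp_out_def out_arcs_X_Int[OF A_arcs_sub[OF k]] out_arcs_X_Int[OF D_arcs_sub[OF k']]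
      out_arcs_Q_Int[OF A_orbitals_sub[OF k]] out_arcs_Q_Int[OF D_orbitals_sub[OF k']]
    by simp
qed

lemma D_0_tail: "e \<in> D_arcs n E C 0 \<Longrightarrow> fst e = Src"
  and D_last_head: "e \<in> D_arcs n E C (length C) \<Longrightarrow> snd e = Snk"
  using gates by (auto simp: D_arcs_def split: if_splits)

lemma D_0_orbital_tail: "{W \<in> D_orbitals n E C 0. fst ` W = vorbit Src} = D_orbitals n E C 0"
  using out_arcs_Q_Int[OF D_orbitals_sub, of 0 "{Src}"] by (simp add: out_arcs_Q_Src vorbit_Src)

lemma D_last_orbital_head:
  "{W \<in> D_orbitals n E C (length C). snd ` W = vorbit Snk} = D_orbitals n E C (length C)"
  using in_arcs_Q_Int[OF D_orbitals_sub, of "length C" "{Snk}"] by (simp add: in_arcs_Q_Snk vorbit_Snk)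

lemma spp_source_eq_rspp_source:
  assumes os: "orbital_subst n E C (lam, \<theta>) (x, y)"
  shows "spp_source n E C y = rspp_source n E C \<theta>"
proof -
  have "{e \<in> D_arcs n E C 0. fst e = Src} = D_arcs n E C 0" using D_0_tail by blast
  then show ?thesis
    using invariant_arcs.sum_fibre[OF D_arcs_tails[OF le0] Src_verts orbital_subst_D[OF os le0]] D_0_orbital_tail
    by (simp add: spp_source_def rspp_source_def out_deg_eq_fibre_size D_orbitals_def)
qed

lemma spp_sink_eq_rspp_sink:
  assumes os: "orbital_subst n E C (lam, \<theta>) (x, y)"
  shows "spp_sink n E C y = rspp_sink n E C \<theta>"
proof -
  have "{e \<in> D_arcs n E C (length C). snd e = Snk} = D_arcs n E C (length C)" using D_last_head by blast
  then show ?thesis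
    using invariant_arcs.sum_fibre[OF D_arcs_heads[OF order_refl] Snk_verts orbital_subst_D[OF os order_refl]]
      D_last_orbital_head
    by (simp add: spp_sink_def rspp_sink_def in_deg_eq_fibre_size D_orbitals_def)
qed

lemma spp_cost_eq_rspp_cost:
  assumes os: "orbital_subst n E C (lam, \<theta>) (x, y)"
  shows "spp_cost n E C (x, y) = rspp_cost n E C (lam, \<theta>)"
proof -
  have "(\<Sum>e\<in>A_arcs n E k. x e) = (\<Sum>W\<in>A_orbitals n E C k. real (card W) * lam W)"
    if k: "k \<in> {1..length C}" for k
    using invariant_arcs.sum_orbitals[OF A_arcs_tails[OF k], of x "\<lambda>_. True"] orbital_subst_A[OF os k]
    by (simp add: A_orbitals_def)
  then show ?thesis by (simp add: spp_cost_def rspp_cost_def)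
qed

lemma ball_A_arcs:
  assumes "k \<in> {1..length C}"
  shows "(\<forall>e\<in>A_arcs n E k. P e) \<longleftrightarrow> (\<forall>W\<in>A_orbitals n E C k. \<forall>e\<in>W. P e)"
  using invariant_arcs.mem_orbital_iff[OF A_arcs_tails[OF assms]] unfolding A_orbitals_def by blast

lemma ball_D_arcs:
  assumes "k \<le> length C"
  shows "(\<forall>e\<in>D_arcs n E C k. P e) \<longleftrightarrow> (\<forall>W\<in>D_orbitals n E C k. \<forall>e\<in>W. P e)"
  using invariant_arcs.mem_orbital_iff[OF D_arcs_tails[OF assms]] unfolding D_orbitals_def by blast

lemma ball_layer:
  assumes k: "k \<in> {1..length C}"
  shows "(\<forall>v\<in>layer n k. P (vorbit v)) \<longleftrightarrow> (\<forall>U\<in>V_orbits n E C k. P U)"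
  using vorbit_in_V_orbits V_orbits_nonempty[OF k] V_orbits_iff[OF k] by metis

lemma spp_feasible_iff_rspp_feasible:
  assumes os: "orbital_subst n E C (lam, \<theta>) (x, y)"
  shows "spp_feasible n E C (x, y) \<longleftrightarrow> rspp_feasible n E C (lam, \<theta>)"
proof -
  have "(\<forall>v\<in>layer n k. spp_in n E C x y k v = spp_out n E C x y k v) \<longleftrightarrow>
      (\<forall>U\<in>V_orbits n E C k. rspp_in n E C lam \<theta> k U = rspp_out n E C lam \<theta> k U)"
    if k: "k \<in> {1..length C}" for k
    using ball_layer[OF k, of "\<lambda>U. rspp_in n E C lam \<theta> k U = rspp_out n E C lam \<theta> k U"]
      spp_in_eq_rspp_in[OF k _ os] spp_out_eq_rspp_out[OF k _ os] by simp
  moreover have "(\<forall>e\<in>A_arcs n E k. 0 \<le> x e \<and> x e \<le> 1) \<longleftrightarrow>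
      (\<forall>W\<in>A_orbitals n E C k. 0 \<le> lam W \<and> lam W \<le> 1)" if k: "k \<in> {1..length C}" for k
  proof -
    have "(\<forall>e\<in>W. 0 \<le> x e \<and> x e \<le> 1) \<longleftrightarrow> 0 \<le> lam W \<and> lam W \<le> 1" if "W \<in> A_orbitals n E C k" for W
      using orbital_subst_A[OF os k, of W] orbital_nonempty[of W] A_orbitals_sub[OF k] that
      unfolding A_orbitals_def by (metis subsetD)
    then show ?thesis unfolding ball_A_arcs[OF k] by blast
  qed
  moreover have "(\<forall>e\<in>D_arcs n E C k. 0 \<le> y e \<and> y e \<le> 1) \<longleftrightarrow>
      (\<forall>W\<in>D_orbitals n E C k. 0 \<le> \<theta> W \<and> \<theta> W \<le> 1)" if k: "k \<le> length C" for k
  proof -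
    have "(\<forall>e\<in>W. 0 \<le> y e \<and> y e \<le> 1) \<longleftrightarrow> 0 \<le> \<theta> W \<and> \<theta> W \<le> 1" if "W \<in> D_orbitals n E C k" for W
      using orbital_subst_D[OF os k, of W] orbital_nonempty[of W] D_orbitals_sub[OF k] that
      unfolding D_orbitals_def by (metis subsetD)
    then show ?thesis unfolding ball_D_arcs[OF k] by blast
  qed
  ultimately show ?thesis
    by (simp add: spp_feasible_def rspp_feasible_def spp_source_eq_rspp_source[OF os] spp_sink_eq_rspp_sink[OF os])
qed

lemma orbital_subst_exists: "\<exists>x y. orbital_subst n E C (lam, \<theta>) (x, y)"
proof -
  have orb: "orbit (GX n E C) (arc_action n E C) e = W" if "W \<in> arcs Q" "e \<in> W" for W e
    using tails.A.orbits_memD(2) that unfolding arcs_Q by blast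
  have "orbital_subst n E C (lam, \<theta>)
      (\<lambda>e. lam (orbit (GX n E C) (arc_action n E C) e), \<lambda>e. \<theta> (orbit (GX n E C) (arc_action n E C) e))"
    using orb A_orbitals_sub D_orbitals_sub unfolding orbital_subst_def by fastforce
  then show ?thesis by blast
qed

text \<open>
  The mean over an orbital, which is the mean over the group without reference to stabilizers.
\<close>

definition average :: "(arc \<Rightarrow> real) \<Rightarrow> arc set \<Rightarrow> real" where
  "average f W = sum f W / real (card W)"

lemma orbital_finite: "W \<in> arcs Q \<Longrightarrow> finite W"
  using tails.finite_orbital unfolding arcs_Q by blast

lemma card_orbital_pos: "W \<in> arcs Q \<Longrightarrow> 0 < card W"
  using orbital_finite orbital_nonempty by (auto simp: card_gt_0_iff)

lemma average_bounds:
  assumes W: "W \<in> arcs Q" and f: "\<forall>e\<in>W. 0 \<le> f e \<and> f e \<le> 1"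
  shows "0 \<le> average f W \<and> average f W \<le> 1"
proof -
  have "sum f W \<le> real (card W)" using f sum_bounded_above[of W f 1] by simp
  then show ?thesis
    using f card_orbital_pos[OF W] by (simp add: average_def sum_nonneg)
qed

text \<open>
  Together with its counterpart for outgoing arcs: conservation on average over an orbit of
  vertices is conservation of the averaged flow in (RSPP).
\<close>

lemma average_in:
  assumes k: "k \<in> {1..length C}" and U: "U \<in> V_orbits n E C k"
  shows "(\<Sum>v\<in>U. spp_in n E C x y k v) = real (card U) * rspp_in n E C (average x) (average y) k U"
proof -
  have V: "U \<in> orbits (GX n E C) (verts (X n E C)) (\<lambda>\<phi>. \<phi>)"
    using V_orbits_sub[OF k] U unfolding verts_Q by blast
  then have fin: "finite U" using tails.B.orbits_memD(1) X.finite_verts by (meson finite_subset subsetI)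
  have k': "k - 1 \<le> length C" "k - 1 < length C" using k by auto
  show ?thesis
    using D_in_deg[OF _ k'(2)] invariant_arcs.sum_orbit[OF A_arcs_heads[OF k] V fin, of x]
      invariant_arcs.sum_orbit[OF D_arcs_heads[OF k'(1)] V fin, of y]
    unfolding spp_in_def rspp_in_def in_arcs_X_Int[OF A_arcs_sub[OF k]] in_arcs_X_Int[OF D_arcs_sub[OF k'(1)]]
      in_arcs_Q_Int[OF A_orbitals_sub[OF k]] in_arcs_Q_Int[OF D_orbitals_sub[OF k'(1)]]
    by (simp add: sum.distrib distrib_left average_def A_orbitals_def[symmetric] D_orbitals_def[symmetric]
        in_deg_eq_fibre_size[symmetric])
qed

lemma average_out:
  assumes k: "k \<in> {1..length C}" and U: "U \<in> V_orbits n E C k"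
  shows "(\<Sum>v\<in>U. spp_out n E C x y k v) = real (card U) * rspp_out n E C (average x) (average y) k U"
proof -
  have V: "U \<in> orbits (GX n E C) (verts (X n E C)) (\<lambda>\<phi>. \<phi>)"
    using V_orbits_sub[OF k] U unfolding verts_Q by blast
  then have fin: "finite U" using tails.B.orbits_memD(1) X.finite_verts by (meson finite_subset subsetI)
  have k': "k \<le> length C" using k by auto
  show ?thesis
    using D_out_deg[OF _ k] invariant_arcs.sum_orbit[OF A_arcs_tails[OF k] V fin, of x]
      invariant_arcs.sum_orbit[OF D_arcs_tails[OF k'] V fin, of y]
    unfolding spp_out_def rspp_out_def out_arcs_X_Int[OF A_arcs_sub[OF k]] out_arcs_X_Int[OF D_arcs_sub[OF k']]
      out_arcs_Q_Int[OF A_orbitals_sub[OF k]] out_arcs_Q_Int[OF D_orbitals_sub[OF k']]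
    by (simp add: sum.distrib distrib_left average_def A_orbitals_def[symmetric] D_orbitals_def[symmetric]
        out_deg_eq_fibre_size[symmetric])
qed

lemma average_source: "rspp_source n E C (average y) = spp_source n E C y"
proof -
  have V: "{Src} \<in> orbits (GX n E C) (verts (X n E C)) (\<lambda>\<phi>. \<phi>)"
    using Src_Q unfolding verts_Q .
  have "{e \<in> D_arcs n E C 0. fst e = Src} = D_arcs n E C 0" using D_0_tail by blast
  then show ?thesis
    using invariant_arcs.sum_orbit[OF D_arcs_tails V, of 0 y] D_0_orbital_tail
    by (simp add: rspp_source_def spp_source_def average_def out_deg_eq_fibre_size D_orbitals_def vorbit_Src)
qed

lemma average_sink: "rspp_sink n E C (average y) = spp_sink n E C y"
proof -
  have V: "{Snk} \<in> orbits (GX n E C) (verts (X n E C)) (\<lambda>\<phi>. \<phi>)"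
    using Snk_Q unfolding verts_Q .
  have "{e \<in> D_arcs n E C (length C). snd e = Snk} = D_arcs n E C (length C)" using D_last_head by blast
  then show ?thesis
    using invariant_arcs.sum_orbit[OF D_arcs_heads V, of "length C" y] D_last_orbital_head
    by (simp add: rspp_sink_def spp_sink_def average_def in_deg_eq_fibre_size D_orbitals_def vorbit_Snk)
qed

lemma average_cost: "rspp_cost n E C (average x, average y) = spp_cost n E C (x, y)"
proof -
  have "(\<Sum>W\<in>A_orbitals n E C k. real (card W) * average x W) = (\<Sum>e\<in>A_arcs n E k. x e)"
    if k: "k \<in> {1..length C}" for k
  proof -
    have "(\<Sum>W\<in>A_orbitals n E C k. real (card W) * average x W) = (\<Sum>W\<in>A_orbitals n E C k. sum x W)"
      using card_orbital_pos A_orbitals_sub[OF k] by (intro sum.cong) (force simp: average_def)+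
    then show ?thesis
      using invariant_arcs.sum_orbitals[OF A_arcs_tails[OF k], of x "\<lambda>_. True"] by (simp add: A_orbitals_def)
  qed
  then show ?thesis by (simp add: spp_cost_def rspp_cost_def)
qed

lemma average_feasible:
  assumes feas: "spp_feasible n E C (x, y)"
  shows "rspp_feasible n E C (average x, average y)"
proof -
  have "rspp_in n E C (average x) (average y) k U = rspp_out n E C (average x) (average y) k U"
    if k: "k \<in> {1..length C}" and U: "U \<in> V_orbits n E C k" for k U
  proof -
    have "v \<in> layer n k" if "v \<in> U" for v using V_orbits_iff[OF k that] U by blast
    then have "(\<Sum>v\<in>U. spp_in n E C x y k v) = (\<Sum>v\<in>U. spp_out n E C x y k v)"
      using feas k by (intro sum.cong) (auto simp: spp_feasible_def)
    moreover have "finite U"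
      using V_orbits_sub[OF k] U tails.B.orbits_memD(1) X.finite_verts unfolding verts_Q
      by (meson finite_subset subsetD subsetI)
    then have "real (card U) \<noteq> 0" using V_orbits_nonempty[OF k U] by (auto simp: card_eq_0_iff)
    ultimately show ?thesis unfolding average_in[OF k U] average_out[OF k U] by simp
  qed
  moreover have "0 \<le> average x W \<and> average x W \<le> 1"
    if k: "k \<in> {1..length C}" and W: "W \<in> A_orbitals n E C k" for k W
  proof -
    have "\<forall>e\<in>A_arcs n E k. 0 \<le> x e \<and> x e \<le> 1" using feas k by (simp add: spp_feasible_def)
    then show ?thesis
      using average_bounds W A_orbitals_sub[OF k] unfolding ball_A_arcs[OF k] by blast
  qed
  moreover have "0 \<le> average y W \<and> average y W \<le> 1"
    if k: "k \<le> length C" and W: "W \<in> D_orbitals n E C k" for k W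
  proof -
    have "\<forall>e\<in>D_arcs n E C k. 0 \<le> y e \<and> y e \<le> 1" using feas k by (simp add: spp_feasible_def)
    then show ?thesis
      using average_bounds W D_orbitals_sub[OF k] unfolding ball_D_arcs[OF k] by blast
  qed
  ultimately show ?thesis
    using feas by (simp add: rspp_feasible_def spp_feasible_def average_source average_sink)
qed

lemma spp_to_rspp:
  "spp_feasible n E C z \<Longrightarrow> \<exists>w. rspp_feasible n E C w \<and> rspp_cost n E C w = spp_cost n E C z"
  using average_feasible average_cost by (cases z) blast

lemma rspp_to_spp:
  "rspp_feasible n E C w \<Longrightarrow> \<exists>z. spp_feasible n E C z \<and> spp_cost n E C z = rspp_cost n E C w"
  using orbital_subst_exists spp_feasible_iff_rspp_feasible spp_cost_eq_rspp_cost by (cases w) metis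

end

section \<open>(RSPP) and (GNFP)\<close>

context routing
begin

text \<open>
  In the new units \<open>f\<close> is the outgoing term of (RSPP) and \<open>p * f\<close> is the incoming
  term, for each family of orbitals.  The families leaving the source and entering the sink are the
  ones on which \<open>f\<close> or \<open>p\<close> carries a degree that the inner families
  \<open>D_arcs\<close> do not have.
\<close>

lemma flow_subst_A:
  assumes "flow_subst n E C (lam, \<theta>) f" "k \<in> {1..length C}" "W \<in> A_orbitals n E C k"
  shows "f W = real (out_deg W) * lam W" "gnfp_p n E C W * f W = real (in_deg W) * lam W"
proof -
  show f: "f W = real (out_deg W) * lam W" using assms by (auto simp: flow_subst_def)
  have "gnfp_p n E C W = real (in_deg W) / real (out_deg W)"
    using assms(2,3) by (auto simp: gnfp_p_def)
  then show "gnfp_p n E C W * f W = real (in_deg W) * lam W"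
    using out_deg_pos[of W] A_orbitals_sub[OF assms(2)] assms(3) f by auto
qed

lemma D_notin_A: "W \<in> D_orbitals n E C k \<Longrightarrow> k \<le> length C \<Longrightarrow> W \<notin> (\<Union>j\<in>{1..length C}. A_orbitals n E C j)"
  using A_D_disjoint by blast

lemma flow_subst_D:
  assumes "flow_subst n E C (lam, \<theta>) f" "k \<in> {1..length C}" "W \<in> D_orbitals n E C k"
  shows "f W = \<theta> W"
  using assms by (auto simp: flow_subst_def)

lemma flow_subst_D_0:
  assumes "flow_subst n E C (lam, \<theta>) f" "W \<in> D_orbitals n E C 0"
  shows "f W = real (out_deg W) * \<theta> W"
  using assms by (auto simp: flow_subst_def)

lemma flow_subst_D_last:
  assumes "flow_subst n E C (lam, \<theta>) f" "W \<in> D_orbitals n E C (length C)"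
  shows "gnfp_p n E C W * f W = real (in_deg W) * \<theta> W"
  using flow_subst_D[OF assms(1) _ assms(2)] D_notin_A[OF assms(2)] assms(2) gates
  by (simp add: gnfp_p_def)

lemma flow_subst_D_in:
  assumes fs: "flow_subst n E C (lam, \<theta>) f" and k: "k < length C" and W: "W \<in> D_orbitals n E C k"
  shows "gnfp_p n E C W * f W = \<theta> W"
proof -
  have kl: "k \<le> length C" using k by simp
  have "W \<notin> D_orbitals n E C (length C)" using D_D_disjoint[OF W kl] k by blast
  then have p: "gnfp_p n E C W = (if W \<in> D_orbitals n E C 0 then 1 / real (out_deg W) else 1)"
    using D_notin_A[OF W kl] by (auto simp: gnfp_p_def)
  show ?thesis
  proof (cases "k = 0")
    case True
    then show ?thesis
      using p W flow_subst_D_0[OF fs] out_deg_pos[of W] D_orbitals_sub[OF kl] by auto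
  next
    case False
    then have "W \<notin> D_orbitals n E C 0" using D_D_disjoint[OF W kl] by blast
    then show ?thesis using p flow_subst_D[OF fs _ W] k False by simp
  qed
qed

lemma gnf_out_sum:
  assumes fs: "flow_subst n E C (lam, \<theta>) f" and k: "k \<in> {1..length C}" and U: "U \<in> V_orbits n E C k"
  shows "sum f (out_arcs Q U) = rspp_out n E C lam \<theta> k U"
  unfolding sum_out_arcs_Q[OF k U] rspp_out_def
  using flow_subst_A(1)[OF fs k] flow_subst_D[OF fs k] by simp

lemma gnf_in_sum:
  assumes fs: "flow_subst n E C (lam, \<theta>) f" and k: "k \<in> {1..length C}" and U: "U \<in> V_orbits n E C k"
  shows "(\<Sum>W\<in>in_arcs Q U. gnfp_p n E C W * f W) = rspp_in n E C lam \<theta> k U"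
proof -
  have "k - 1 < length C" using k by auto
  then show ?thesis
    unfolding sum_in_arcs_Q[OF k U] rspp_in_def
    using flow_subst_A(2)[OF fs k] flow_subst_D_in[OF fs] by simp
qed

lemma gnf_bounds_A:
  assumes fs: "flow_subst n E C (lam, \<theta>) f" and k: "k \<in> {1..length C}" and W: "W \<in> A_orbitals n E C k"
  shows "0 \<le> f W \<and> f W \<le> gnfp_u n E C W \<longleftrightarrow> 0 \<le> lam W \<and> lam W \<le> 1"
proof -
  have "gnfp_u n E C W = real (out_deg W)"
    using A_D_disjoint[OF W k] by (auto simp: gnfp_u_def)
  then show ?thesis
    using out_deg_pos[of W] A_orbitals_sub[OF k] W flow_subst_A(1)[OF fs k W]
    by (auto simp: zero_le_mult_iff)
qed

lemma gnf_bounds_D: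
  assumes fs: "flow_subst n E C (lam, \<theta>) f" and k: "k \<le> length C" and W: "W \<in> D_orbitals n E C k"
  shows "0 \<le> f W \<and> f W \<le> gnfp_u n E C W \<longleftrightarrow> 0 \<le> \<theta> W \<and> \<theta> W \<le> 1"
proof (cases "k = 0")
  case True
  then have "W \<notin> D_orbitals n E C j" if "j \<in> {1..length C}" for j
    using D_D_disjoint[OF W k] that by fastforce
  then have "gnfp_u n E C W = real (out_deg W)" by (auto simp: gnfp_u_def)
  then show ?thesis
    using out_deg_pos[of W] D_orbitals_sub[OF k] W flow_subst_D_0[OF fs] True
    by (auto simp: zero_le_mult_iff)
next
  case False
  then have k': "k \<in> {1..length C}" using k by auto
  then have "gnfp_u n E C W = 1" using W by (auto simp: gnfp_u_def)
  then show ?thesis using flow_subst_D[OF fs k' W] by simp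
qed

lemma ball_verts_Q:
  "(\<forall>U\<in>verts Q - {{Src}, {Snk}}. P U) \<longleftrightarrow> (\<forall>k\<in>{1..length C}. \<forall>U\<in>V_orbits n E C k. P U)"
  unfolding Ball_def inner_orbits_iff by blast

lemma ball_arcs_Q:
  "(\<forall>W\<in>arcs Q. P W) \<longleftrightarrow> (\<forall>k\<in>{1..length C}. \<forall>W\<in>A_orbitals n E C k. P W) \<and>
     (\<forall>k\<in>{0..length C}. \<forall>W\<in>D_orbitals n E C k. P W)" (is "?L \<longleftrightarrow> ?R")
proof
  show "?L \<Longrightarrow> ?R" using A_orbitals_sub D_orbitals_sub by (fastforce dest: subsetD)
  assume R: ?R
  show ?L
  proof
    fix W assume "W \<in> arcs Q"
    then show "P W" by (cases rule: arcs_Q_cases) (use R in auto)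
  qed
qed

lemma gnfp_feasible_iff_rspp_feasible:
  assumes fs: "flow_subst n E C (lam, \<theta>) f"
  shows "gnfp_feasible n E C f \<longleftrightarrow> rspp_feasible n E C (lam, \<theta>)"
proof -
  have "(\<Sum>W\<in>out_arcs Q {Src}. f W) = rspp_source n E C \<theta>"
    unfolding out_arcs_Q_Src rspp_source_def using flow_subst_D_0[OF fs] by simp
  moreover have "(\<Sum>W\<in>in_arcs Q {Snk}. gnfp_p n E C W * f W) = rspp_sink n E C \<theta>"
    unfolding in_arcs_Q_Snk rspp_sink_def using flow_subst_D_last[OF fs] by simp
  moreover have "(\<forall>U\<in>verts Q - {{Src}, {Snk}}.
        sum f (out_arcs Q U) = (\<Sum>W\<in>in_arcs Q U. gnfp_p n E C W * f W)) \<longleftrightarrow>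
      (\<forall>k\<in>{1..length C}. \<forall>U\<in>V_orbits n E C k. rspp_in n E C lam \<theta> k U = rspp_out n E C lam \<theta> k U)"
    unfolding ball_verts_Q
  proof (intro ball_cong refl)
    fix k U assume k: "k \<in> {1..length C}" and U: "U \<in> V_orbits n E C k"
    show "sum f (out_arcs Q U) = (\<Sum>W\<in>in_arcs Q U. gnfp_p n E C W * f W) \<longleftrightarrow>
        rspp_in n E C lam \<theta> k U = rspp_out n E C lam \<theta> k U"
      unfolding gnf_out_sum[OF fs k U] gnf_in_sum[OF fs k U] by (rule eq_commute)
  qed
  moreover have "(\<forall>W\<in>arcs Q. 0 \<le> f W \<and> f W \<le> gnfp_u n E C W) \<longleftrightarrow>
      (\<forall>k\<in>{1..length C}. \<forall>W\<in>A_orbitals n E C k. 0 \<le> lam W \<and> lam W \<le> 1) \<and>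
      (\<forall>k\<in>{0..length C}. \<forall>W\<in>D_orbitals n E C k. 0 \<le> \<theta> W \<and> \<theta> W \<le> 1)"
    unfolding ball_arcs_Q
    by (rule arg_cong2[of _ _ _ _ "(\<and>)"]; intro ball_cong refl gnf_bounds_A[OF fs] gnf_bounds_D[OF fs]) auto
  ultimately show ?thesis
    by (simp add: gnfp_feasible_def gnf_feasible_def rspp_feasible_def)
qed

lemma gnfp_cost_eq_rspp_cost:
  assumes fs: "flow_subst n E C (lam, \<theta>) f"
  shows "gnfp_cost n E C f = rspp_cost n E C (lam, \<theta>)"
proof -
  interpret Q: fin_digraph Q by (rule fin_digraph_Q)
  let ?A = "\<Union>k\<in>{1..length C}. A_orbitals n E C k"
  have sub: "?A \<subseteq> arcs Q" using A_orbitals_sub by blast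
  have "gnfp_cost n E C f = (\<Sum>W\<in>arcs Q. if W \<in> ?A then real (card W) * lam W else 0)"
    unfolding gnfp_cost_def gnf_cost_def
  proof (rule sum.cong[OF refl])
    fix W assume W: "W \<in> arcs Q"
    show "gnfp_w n E C W * f W = (if W \<in> ?A then real (card W) * lam W else 0)"
      using flow_subst_A(1)[OF fs, of _ W] out_deg_pos[OF W] by (auto simp: gnfp_w_def)
  qed
  also have "\<dots> = (\<Sum>W\<in>?A. real (card W) * lam W)"
    by (simp only: sum.inter_restrict[OF Q.finite_arcs, symmetric] inf_absorb2[OF sub])
  also have "\<dots> = (\<Sum>k=1..length C. \<Sum>W\<in>A_orbitals n E C k. real (card W) * lam W)"
    using A_A_disjoint finite_subset[OF A_orbitals_sub Q.finite_arcs]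
    by (intro sum.UNION_disjoint) blast+
  finally show ?thesis by (simp add: rspp_cost_def)
qed

lemma flow_subst_exists: "\<exists>f. flow_subst n E C (lam, \<theta>) f"
proof -
  define f where "f W = (if W \<in> (\<Union>k\<in>{1..length C}. A_orbitals n E C k) then real (out_deg W) * lam W
    else if W \<in> D_orbitals n E C 0 then real (out_deg W) * \<theta> W else \<theta> W)" for W
  have "f W = real (out_deg W) * \<theta> W" if "W \<in> D_orbitals n E C 0" for W
    using D_notin_A[OF that] that by (simp add: f_def)
  moreover have "f W = \<theta> W" if "k \<in> {1..length C}" "W \<in> D_orbitals n E C k" for k W
    using D_notin_A[OF that(2)] D_D_disjoint[OF that(2), of 0] that by (auto simp: f_def)
  moreover have "f W = real (out_deg W) * lam W" if "k \<in> {1..length C}" "W \<in> A_orbitals n E C k" for k W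
    using that by (auto simp: f_def)
  ultimately show ?thesis unfolding flow_subst_def by blast
qed

lemma flow_subst_solvable: "\<exists>lam \<theta>. flow_subst n E C (lam, \<theta>) f"
proof -
  define lam where "lam W = f W / real (out_deg W)" for W
  define \<theta> where "\<theta> W = (if W \<in> D_orbitals n E C 0 then f W / real (out_deg W) else f W)" for W
  have "f W = real (out_deg W) * \<theta> W" if "W \<in> D_orbitals n E C 0" for W
    using that out_deg_pos D_orbitals_sub[of 0] by (force simp: \<theta>_def)
  moreover have "f W = \<theta> W" if "k \<in> {1..length C}" "W \<in> D_orbitals n E C k" for k W
    using D_D_disjoint[OF that(2), of 0] that by (auto simp: \<theta>_def)
  moreover have "f W = real (out_deg W) * lam W" if "k \<in> {1..length C}" "W \<in> A_orbitals n E C k" for k W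
    using that out_deg_pos A_orbitals_sub[OF that(1)] by (force simp: lam_def)
  ultimately show ?thesis unfolding flow_subst_def by blast
qed

lemma rspp_to_gnfp:
  "rspp_feasible n E C w \<Longrightarrow> \<exists>f. gnfp_feasible n E C f \<and> gnfp_cost n E C f = rspp_cost n E C w"
  using flow_subst_exists gnfp_feasible_iff_rspp_feasible gnfp_cost_eq_rspp_cost by (cases w) metis

lemma gnfp_to_rspp:
  "gnfp_feasible n E C f \<Longrightarrow> \<exists>w. rspp_feasible n E C w \<and> rspp_cost n E C w = gnfp_cost n E C f"
  using flow_subst_solvable gnfp_feasible_iff_rspp_feasible gnfp_cost_eq_rspp_cost by metis

lemma generalized_network_Q:
  "generalized_network Q {Src} {Snk} (gnfp_u n E C) (gnfp_p n E C)"
proof -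
  have "0 \<le> gnfp_u n E C W" for W by (simp add: gnfp_u_def)
  moreover have "0 < gnfp_p n E C W" if "W \<in> arcs Q" for W
    using out_deg_pos[OF that] in_deg_pos[OF that] by (simp add: gnfp_p_def)
  ultimately show ?thesis
    using fin_digraph_Q Src_Q Snk_Q by (simp add: generalized_network_def)
qed

end

section \<open>(SPP) and shortest paths\<close>

context routing
begin

lemma arcs_X_levels:
  assumes "e \<in> arcs (X n E C)"
  shows "level (snd e) = level (fst e) \<and> level (fst e) \<in> {1..length C} \<and> e \<in> A_arcs n E (level (fst e)) \<or>
     level (snd e) = Suc (level (fst e)) \<and> level (fst e) \<le> length C \<and> e \<in> D_arcs n E C (level (fst e))"
  using assms
proof (cases rule: arcs_X_cases)
  case (A k)
  then show ?thesis using A_arcs_endpoints[OF A(2,1)] by simp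
next
  case (D k)
  then show ?thesis using D_arcs_endpoints[OF D(2,1)] by simp
qed

lemma out_arcs_X_Src: "out_arcs (X n E C) Src = D_arcs n E C 0"
  and in_arcs_X_Src: "in_arcs (X n E C) Src = {}"
  and out_arcs_X_Snk: "out_arcs (X n E C) Snk = {}"
  and in_arcs_X_Snk: "in_arcs (X n E C) Snk = D_arcs n E C (length C)"
proof -
  have lev: "level (fst e) \<le> level (snd e) \<and> level (snd e) \<noteq> 0 \<and> level (fst e) \<noteq> Suc (length C) \<and>
     (level (fst e) = 0 \<longrightarrow> e \<in> D_arcs n E C 0) \<and>
     (level (snd e) = Suc (length C) \<longrightarrow> e \<in> D_arcs n E C (length C))" if "e \<in> arcs (X n E C)" for e
    using arcs_X_levels[OF that] by auto
  show "out_arcs (X n E C) Src = D_arcs n E C 0"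
    using lev D_0_tail D_arcs_sub[of 0] by force
  show "in_arcs (X n E C) Src = {}" using lev by force
  show "out_arcs (X n E C) Snk = {}" using lev by force
  show "in_arcs (X n E C) Snk = D_arcs n E C (length C)"
    using lev D_last_head D_arcs_sub[of "length C"] by force
qed

lemma sum_out_arcs_X:
  fixes z :: "arc \<Rightarrow> real"
  assumes k: "k \<in> {1..length C}" and v: "v \<in> layer n k"
  shows "sum z (out_arcs (X n E C) v) = spp_out n E C z z k v"
proof -
  have k': "k \<le> length C" using k by simp
  have lv: "level v = k" using layer_iff[OF k] v by blast
  have "e \<in> D_arcs n E C k \<or> e \<in> A_arcs n E k" if "e \<in> out_arcs (X n E C) v" for e
    using that arcs_X_levels[of e] lv by auto
  then have "out_arcs (X n E C) v =
      (out_arcs (X n E C) v \<inter> D_arcs n E C k) \<union> (out_arcs (X n E C) v \<inter> A_arcs n E k)" by blast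
  moreover have "(out_arcs (X n E C) v \<inter> D_arcs n E C k) \<inter> (out_arcs (X n E C) v \<inter> A_arcs n E k) = {}"
    using A_arcs_iff[OF k] D_arcs_iff[OF k'] by auto
  ultimately show ?thesis
    unfolding spp_out_def by (metis X.finite_out_arcs finite_Int sum.union_disjoint)
qed

lemma sum_in_arcs_X:
  fixes z :: "arc \<Rightarrow> real"
  assumes k: "k \<in> {1..length C}" and v: "v \<in> layer n k"
  shows "sum z (in_arcs (X n E C) v) = spp_in n E C z z k v"
proof -
  have k': "k - 1 \<le> length C" using k by auto
  have lv: "level v = k" using layer_iff[OF k] v by blast
  have "e \<in> D_arcs n E C (k - 1) \<or> e \<in> A_arcs n E k" if "e \<in> in_arcs (X n E C) v" for e
    using that arcs_X_levels[of e] lv by auto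
  then have "in_arcs (X n E C) v =
      (in_arcs (X n E C) v \<inter> D_arcs n E C (k - 1)) \<union> (in_arcs (X n E C) v \<inter> A_arcs n E k)" by blast
  moreover have "(in_arcs (X n E C) v \<inter> D_arcs n E C (k - 1)) \<inter> (in_arcs (X n E C) v \<inter> A_arcs n E k) = {}"
    using A_arcs_iff[OF k] D_arcs_iff[OF k'] by auto
  ultimately show ?thesis
    unfolding spp_in_def by (metis X.finite_in_arcs finite_Int sum.union_disjoint)
qed

lemma ball_verts_X:
  "(\<forall>v\<in>verts (X n E C). P v) \<longleftrightarrow> P Src \<and> P Snk \<and> (\<forall>k\<in>{1..length C}. \<forall>v\<in>layer n k. P v)"
  by (auto simp: X_def)

lemma ball_arcs_X:
  "(\<forall>e\<in>arcs (X n E C). P e) \<longleftrightarrow> (\<forall>k\<in>{1..length C}. \<forall>e\<in>A_arcs n E k. P e) \<and>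
     (\<forall>k\<in>{0..length C}. \<forall>e\<in>D_arcs n E C k. P e)"
  by (auto simp: X_def)

text \<open>
  (SPP) has separate variables for the two kinds of arcs, a flow in \<open>X\<close> has one function.
  On pairs \<open>(z, z)\<close> the two views agree, and every pair \<open>(x, y)\<close> can be replaced by
  such a pair because the two kinds of arcs are disjoint.
\<close>

lemma spp_feasible_iff_unit_flow:
  "spp_feasible n E C (z, z) \<longleftrightarrow> X.unit_flow z Src Snk \<and> (\<forall>e\<in>arcs (X n E C). z e \<le> 1)"
proof -
  have "v \<noteq> Src \<and> v \<noteq> Snk" if "k \<in> {1..length C}" "v \<in> layer n k" for k v
    using that by (auto simp: layer_def)
  then have "X.unit_flow z Src Snk \<longleftrightarrow> (\<forall>e\<in>arcs (X n E C). 0 \<le> z e) \<and>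
      spp_source n E C z = 1 \<and> spp_sink n E C z = 1 \<and>
      (\<forall>k\<in>{1..length C}. \<forall>v\<in>layer n k. spp_in n E C z z k v = spp_out n E C z z k v)"
    unfolding X.unit_flow_def ball_verts_X spp_source_def spp_sink_def
    using sum_in_arcs_X sum_out_arcs_X
    by (auto simp: out_arcs_X_Src in_arcs_X_Src out_arcs_X_Snk in_arcs_X_Snk)
  then show ?thesis
    unfolding spp_feasible_def ball_arcs_X by auto
qed

lemma spp_cost_eq_arc_cost: "spp_cost n E C (z, y) = (\<Sum>e\<in>arcs (X n E C). arc_cost n E C e * z e)"
proof -
  let ?A = "\<Union>k\<in>{1..length C}. A_arcs n E k"
  have "A_arcs n E k \<inter> A_arcs n E l = {}" if "k \<in> {1..length C}" "l \<in> {1..length C}" "k \<noteq> l" for k l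
    using A_arcs_iff[OF that(1)] A_arcs_iff[OF that(2)] that(3) by auto
  then have "spp_cost n E C (z, y) = sum z ?A"
    using finite_subset[OF A_arcs_sub X.finite_arcs] unfolding spp_cost_def prod.case
    by (intro sum.UNION_disjoint[symmetric]) blast+
  also have "\<dots> = (\<Sum>e\<in>arcs (X n E C). if e \<in> ?A then z e else 0)"
    using A_arcs_sub
    by (subst sum.inter_restrict[symmetric]) (auto simp: subset_iff intro!: arg_cong[where f = "sum z"])
  finally show ?thesis by (simp add: arc_cost_def if_distrib[of "\<lambda>c. c * _"] cong: if_cong)
qed

lemma spp_feasible_merge:
  assumes "spp_feasible n E C (x, y)"
  obtains z where "spp_feasible n E C (z, z)" "spp_cost n E C (z, z) = spp_cost n E C (x, y)"
proof -
  define z where "z e = (if e \<in> (\<Union>k\<in>{1..length C}. A_arcs n E k) then x e else y e)" for e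
  have A: "z e = x e" if "k \<in> {1..length C}" "e \<in> A_arcs n E k" for k e
    using that by (auto simp: z_def)
  have D: "z e = y e" if "k \<le> length C" "e \<in> D_arcs n E C k" for k e
    using that D_arcs_iff[OF that(1)] A_arcs_iff by (auto simp: z_def)
  have "spp_in n E C z z k v = spp_in n E C x y k v" "spp_out n E C z z k v = spp_out n E C x y k v"
    if "k \<in> {1..length C}" for k v
  proof -
    have "k \<le> length C" "k - 1 \<le> length C" using that by auto
    then show "spp_in n E C z z k v = spp_in n E C x y k v" "spp_out n E C z z k v = spp_out n E C x y k v"
      using A[OF that] D by (auto simp: spp_in_def spp_out_def intro!: sum.cong arg_cong2[of _ _ _ _ "(+)"])
  qed
  moreover have "spp_source n E C z = spp_source n E C y" "spp_sink n E C z = spp_sink n E C y"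
    using D by (auto simp: spp_source_def spp_sink_def intro!: sum.cong)
  ultimately have "spp_feasible n E C (z, z)"
    using assms A D by (simp add: spp_feasible_def)
  moreover have "spp_cost n E C (z, z) = spp_cost n E C (x, y)"
    using A by (simp add: spp_cost_def)
  ultimately show thesis by (rule that)
qed

text \<open>
  The upper bounds of (SPP) hold for the indicator of a path, whose arcs are distinct, and the lower
  bound on costs is valid for all unit flows, bounded by 1 or not.
\<close>

theorem spp_opt_value_shortest_path:
  "\<exists>v. opt_value (wf_digraph.awalk_cost (arc_cost n E C)) (\<lambda>p. X.apath Src p Snk) v \<and>
       opt_value (spp_cost n E C) (spp_feasible n E C) v"
proof -
  let ?c = "arc_cost n E C"
  have pos: "0 \<le> ?c e" for e by (simp add: arc_cost_def)
  obtain p where p: "is_arg_min (X.awalk_cost ?c) (\<lambda>p. X.apath Src p Snk) p"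
    and le: "\<And>z. X.unit_flow z Src Snk \<Longrightarrow> X.awalk_cost ?c p \<le> (\<Sum>e\<in>arcs (X n E C). ?c e * z e)"
    using X.shortest_path_optimal_unit_flow[where c = ?c, OF reaches_Snk Src_verts Snk_verts pos] by blast
  define z :: "arc \<Rightarrow> real" where "z = (\<lambda>e. of_bool (e \<in> set p))"
  have path: "X.apath Src p Snk" using p by (simp add: is_arg_min_def)
  have "spp_feasible n E C (z, z)"
    using X.unit_flow_apath(1)[OF path] unfolding spp_feasible_iff_unit_flow by (simp add: z_def)
  moreover have cost: "spp_cost n E C (z, z) = X.awalk_cost ?c p"
    using X.unit_flow_apath(2)[OF path, of ?c] by (simp add: spp_cost_eq_arc_cost z_def)
  moreover have "X.awalk_cost ?c p \<le> spp_cost n E C (x, y)"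
    if feas: "spp_feasible n E C (x, y)" for x y
  proof -
    obtain w where "spp_feasible n E C (w, w)" "spp_cost n E C (w, w) = spp_cost n E C (x, y)"
      using spp_feasible_merge[OF feas] .
    then show ?thesis using le[of w] by (simp add: spp_feasible_iff_unit_flow spp_cost_eq_arc_cost)
  qed
  ultimately have "is_arg_min (spp_cost n E C) (spp_feasible n E C) (z, z)"
    by (auto simp: is_arg_min_def not_less)
  then show ?thesis using p cost unfolding opt_value_def by blast
qed

end

section \<open>Equivalence of the three programs\<close>

theorem mainTheorem4:
  fixes n :: nat and E :: "nat set set" and C :: "nat set list"
  assumes "n \<ge> 3" and "coupling_graph n E" and "circuit n C" and "length C \<ge> 1"
  shows
    \<comment> \<open>(a) (RSPP) arises from (SPP) by the substitution, one flow constraint per orbit\<close>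
    "(\<forall>lam \<theta> x y. orbital_subst n E C (lam, \<theta>) (x, y) \<longrightarrow>
        spp_cost n E C (x, y) = rspp_cost n E C (lam, \<theta>) \<and>
        spp_source n E C y = rspp_source n E C \<theta> \<and>
        spp_sink n E C y = rspp_sink n E C \<theta> \<and>
        (\<forall>k\<in>{1..length C}. \<forall>u\<in>V_orbits n E C k. \<forall>v\<in>u.
           spp_in n E C x y k v = rspp_in n E C lam \<theta> k u \<and>
           spp_out n E C x y k v = rspp_out n E C lam \<theta> k u) \<and>
        (spp_feasible n E C (x, y) \<longleftrightarrow> rspp_feasible n E C (lam, \<theta>)) \<and>
        (is_arg_min (spp_cost n E C) (spp_feasible n E C) (x, y) \<longleftrightarrow>
         is_arg_min (rspp_cost n E C) (rspp_feasible n E C) (lam, \<theta>))) \<and>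
     (\<forall>lam \<theta>. \<exists>x y. orbital_subst n E C (lam, \<theta>) (x, y)) \<and>
     (\<forall>x y. spp_feasible n E C (x, y) \<longrightarrow>
        (\<exists>lam \<theta>. rspp_feasible n E C (lam, \<theta>) \<and>
           rspp_cost n E C (lam, \<theta>) = spp_cost n E C (x, y))) \<and>
     \<comment> \<open>(b) (GNFP) is a generalized network flow problem equivalent to (RSPP)\<close>
     generalized_network (quotient_graph n E C) {Src} {Snk} (gnfp_u n E C) (gnfp_p n E C) \<and>
     (\<forall>lam \<theta> f. flow_subst n E C (lam, \<theta>) f \<longrightarrow>
        gnfp_cost n E C f = rspp_cost n E C (lam, \<theta>) \<and>
        (gnfp_feasible n E C f \<longleftrightarrow> rspp_feasible n E C (lam, \<theta>)) \<and>
        (is_arg_min (gnfp_cost n E C) (gnfp_feasible n E C) f \<longleftrightarrow>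
         is_arg_min (rspp_cost n E C) (rspp_feasible n E C) (lam, \<theta>))) \<and>
     (\<forall>lam \<theta>. \<exists>f. flow_subst n E C (lam, \<theta>) f) \<and>
     (\<forall>f. \<exists>lam \<theta>. flow_subst n E C (lam, \<theta>) f) \<and>
     \<comment> \<open>all three programs have the cost of a shortest path as their optimal value\<close>
     (\<exists>v. opt_value (wf_digraph.awalk_cost (arc_cost n E C))
            (\<lambda>p. pre_digraph.apath (X n E C) Src p Snk) v \<and>
          opt_value (spp_cost n E C) (spp_feasible n E C) v \<and>
          opt_value (rspp_cost n E C) (rspp_feasible n E C) v \<and>
          opt_value (gnfp_cost n E C) (gnfp_feasible n E C) v)"
proof -
  interpret routing n E C using assms by unfold_locales
  have conservation: "\<forall>k\<in>{1..length C}. \<forall>u\<in>V_orbits n E C k. \<forall>v\<in>u.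
      spp_in n E C x y k v = rspp_in n E C lam \<theta> k u \<and> spp_out n E C x y k v = rspp_out n E C lam \<theta> k u"
    if "orbital_subst n E C (lam, \<theta>) (x, y)" for lam \<theta> x y
    using spp_in_eq_rspp_in spp_out_eq_rspp_out V_orbits_iff that by metis
  have spp_rspp_opt: "is_arg_min (spp_cost n E C) (spp_feasible n E C) (x, y) \<longleftrightarrow>
      is_arg_min (rspp_cost n E C) (rspp_feasible n E C) (lam, \<theta>)"
    if "orbital_subst n E C (lam, \<theta>) (x, y)" for lam \<theta> x y
    by (rule is_arg_min_transfer[OF spp_cost_eq_rspp_cost[OF that] spp_feasible_iff_rspp_feasible[OF that] spp_to_rspp rspp_to_spp])
  have gnfp_rspp_opt: "is_arg_min (gnfp_cost n E C) (gnfp_feasible n E C) f \<longleftrightarrow>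
      is_arg_min (rspp_cost n E C) (rspp_feasible n E C) (lam, \<theta>)"
    if "flow_subst n E C (lam, \<theta>) f" for lam \<theta> f
    by (rule is_arg_min_transfer[OF gnfp_cost_eq_rspp_cost[OF that] gnfp_feasible_iff_rspp_feasible[OF that]
          gnfp_to_rspp rspp_to_gnfp])
  obtain v where v: "opt_value (wf_digraph.awalk_cost (arc_cost n E C)) (\<lambda>p. X.apath Src p Snk) v"
    "opt_value (spp_cost n E C) (spp_feasible n E C) v"
    using spp_opt_value_shortest_path by blast
  have rspp_v: "opt_value (rspp_cost n E C) (rspp_feasible n E C) v"
    by (rule opt_value_transfer[OF spp_to_rspp rspp_to_spp v(2)])
  have gnfp_v: "opt_value (gnfp_cost n E C) (gnfp_feasible n E C) v"
    by (rule opt_value_transfer[OF rspp_to_gnfp gnfp_to_rspp rspp_v])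
  have average: "\<exists>lam \<theta>. rspp_feasible n E C (lam, \<theta>) \<and> rspp_cost n E C (lam, \<theta>) = spp_cost n E C (x, y)"
    if "spp_feasible n E C (x, y)" for x y
    using average_feasible[OF that] average_cost by blast
  show ?thesis
    by (intro conjI allI impI exI[of _ v])
       (fact spp_cost_eq_rspp_cost spp_source_eq_rspp_source spp_sink_eq_rspp_sink conservation spp_feasible_iff_rspp_feasible spp_rspp_opt orbital_subst_exists
          average generalized_network_Q gnfp_cost_eq_rspp_cost gnfp_feasible_iff_rspp_feasible gnfp_rspp_opt flow_subst_exists
          flow_subst_solvable v rspp_v gnfp_v)+
qed

end
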